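(* Let $\mathcal{H}$ be a proper minor-closed class of graphs. Then the Acyclic Matching problem and the Induced Matching problem restricted to input graphs in $\mathcal{H}$ are both fixed-parameter tractable with respect to the parameter $k$.
   Context: All graphs are finite and simple. A class of graphs is minor-closed if it is closed under taking minors, and proper if it does not contain all graphs. A matching $M$ (set of pairwise nonadjacent edges) is acyclic if the subgraph of $G$ induced on the endpoints of the edges of $M$ is acyclic, and induced if that induced subgraph has exactly $|M|$ edges. Acyclic (resp. Induced) Matching problem: given a graph $G$ and a positive integer $k$, decide whether $G$ has an acyclic (resp. induced) matching of size $k$. *)

theory Defs
  imports Complex_Main "HOL-Library.Log_Nat"
begin

section \<open>Finite simple graphs\<close>

record 'a sgraph =
  verts :: "'a set"
  edges :: "'a set set"

definition simple_graph :: "'a sgraph \<Rightarrow> bool" where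
  "simple_graph G \<longleftrightarrow> finite (verts G) \<and>
     (\<forall>e\<in>edges G. \<exists>u v. u \<in> verts G \<and> v \<in> verts G \<and> u \<noteq> v \<and> e = {u, v})"

definition isomorphic :: "'a sgraph \<Rightarrow> 'b sgraph \<Rightarrow> bool" where
  "isomorphic G H \<longleftrightarrow>
     (\<exists>\<phi>. bij_betw \<phi> (verts G) (verts H) \<and> edges H = (\<lambda>e. \<phi> ` e) ` edges G)"

definition induced_subgraph :: "'a sgraph \<Rightarrow> 'a set \<Rightarrow> 'a sgraph" where
  "induced_subgraph G S = \<lparr>verts = verts G \<inter> S, edges = {e \<in> edges G. e \<subseteq> S}\<rparr>"

definition is_cycle :: "'a sgraph \<Rightarrow> 'a list \<Rightarrow> bool" where
  "is_cycle G p \<longleftrightarrow> length p \<ge> 3 \<and> distinct p \<and> set p \<subseteq> verts G \<and>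
     (\<forall>i. Suc i < length p \<longrightarrow> {p ! i, p ! Suc i} \<in> edges G) \<and>
     {last p, hd p} \<in> edges G"

definition acyclic_graph :: "'a sgraph \<Rightarrow> bool" where
  "acyclic_graph G \<longleftrightarrow> (\<nexists>p. is_cycle G p)"


section \<open>Minors\<close>

definition delete_vertex :: "'a sgraph \<Rightarrow> 'a \<Rightarrow> 'a sgraph" where
  "delete_vertex G v = \<lparr>verts = verts G - {v}, edges = {e \<in> edges G. v \<notin> e}\<rparr>"

definition delete_edge :: "'a sgraph \<Rightarrow> 'a set \<Rightarrow> 'a sgraph" where
  "delete_edge G e = \<lparr>verts = verts G, edges = edges G - {e}\<rparr>"

text \<open>The vertex resulting from the contraction of the edge \<open>{u, v}\<close> is again called \<open>u\<close>.
  Parallel edges merge because edges form a set; the loop \<open>{u}\<close> is removed.\<close>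

definition contract_edge :: "'a sgraph \<Rightarrow> 'a \<Rightarrow> 'a \<Rightarrow> 'a sgraph" where
  "contract_edge G u v =
     \<lparr>verts = verts G - {v},
      edges = (\<lambda>e. (\<lambda>x. if x = v then u else x) ` e) ` edges G - {{u}}\<rparr>"

inductive has_minor :: "'a sgraph \<Rightarrow> 'a sgraph \<Rightarrow> bool" for G :: "'a sgraph" where
  refl: "has_minor G G"
| iso: "has_minor G H \<Longrightarrow> isomorphic H H' \<Longrightarrow> has_minor G H'"
| delete_vertex: "has_minor G H \<Longrightarrow> v \<in> verts H \<Longrightarrow> has_minor G (delete_vertex H v)"
| delete_edge: "has_minor G H \<Longrightarrow> e \<in> edges H \<Longrightarrow> has_minor G (delete_edge H e)"
| contract_edge: "has_minor G H \<Longrightarrow> {u, v} \<in> edges H \<Longrightarrow> u \<noteq> v \<Longrightarrow>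
    has_minor G (contract_edge H u v)"

text \<open>Every finite graph has an isomorphic copy with vertices in \<^typ>\<open>nat\<close>, so classes of graphs
  are sets of graphs on natural numbers. Minor-closed classes are closed under isomorphism, since
  isomorphic copies are minors.\<close>

definition graph_class :: "nat sgraph set \<Rightarrow> bool" where
  "graph_class \<H> \<longleftrightarrow> (\<forall>G\<in>\<H>. simple_graph G)"

definition minor_closed :: "nat sgraph set \<Rightarrow> bool" where
  "minor_closed \<H> \<longleftrightarrow> (\<forall>G\<in>\<H>. \<forall>G'. has_minor G G' \<longrightarrow> G' \<in> \<H>)"

definition proper_class :: "nat sgraph set \<Rightarrow> bool" where
  "proper_class \<H> \<longleftrightarrow> (\<exists>G. simple_graph G \<and> G \<notin> \<H>)"


section \<open>Matchings\<close>

definition matching :: "'a sgraph \<Rightarrow> 'a set set \<Rightarrow> bool" where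
  "matching G M \<longleftrightarrow> M \<subseteq> edges G \<and> (\<forall>e\<in>M. \<forall>e'\<in>M. e \<noteq> e' \<longrightarrow> e \<inter> e' = {})"

definition acyclic_matching :: "'a sgraph \<Rightarrow> 'a set set \<Rightarrow> bool" where
  "acyclic_matching G M \<longleftrightarrow> matching G M \<and> acyclic_graph (induced_subgraph G (\<Union>M))"

definition induced_matching :: "'a sgraph \<Rightarrow> 'a set set \<Rightarrow> bool" where
  "induced_matching G M \<longleftrightarrow> matching G M \<and>
     card (edges (induced_subgraph G (\<Union>M))) = card M"


section \<open>Random access machines\<close>

text \<open>The uniform-cost random access machine with addition, truncated subtraction and halving, the
  usual machine model of parameterized complexity theory. Without multiplication, \<open>t\<close> steps
  increase the bit length of the largest number by at most \<open>t\<close> plus a constant, so the model is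
  polynomially equivalent to Turing machines.
  The input is a read-only list of numbers; all registers are initially 0.\<close>

datatype instr =
    Const nat nat    \<comment> \<open>\<open>R i := c\<close>\<close>
  | Add nat nat nat  \<comment> \<open>\<open>R i := R j + R l\<close>\<close>
  | Sub nat nat nat  \<comment> \<open>\<open>R i := R j - R l\<close>\<close>
  | Half nat nat     \<comment> \<open>\<open>R i := R j div 2\<close>\<close>
  | Load nat nat     \<comment> \<open>\<open>R i := R (R j)\<close>\<close>
  | Store nat nat    \<comment> \<open>\<open>R (R i) := R j\<close>\<close>
  | Read nat nat     \<comment> \<open>\<open>R i :=\<close> input number at position \<open>R j\<close>, 0 beyond the end of the input\<close>
  | Jump nat         \<comment> \<open>\<open>goto a\<close>\<close>
  | JumpZero nat nat \<comment> \<open>\<open>if R i = 0 then goto a\<close>\<close>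

type_synonym config = "nat \<times> (nat \<Rightarrow> nat)"

fun exec :: "nat list \<Rightarrow> instr \<Rightarrow> config \<Rightarrow> config" where
  "exec x (Const i c) (pc, R) = (Suc pc, R(i := c))"
| "exec x (Add i j l) (pc, R) = (Suc pc, R(i := R j + R l))"
| "exec x (Sub i j l) (pc, R) = (Suc pc, R(i := R j - R l))"
| "exec x (Half i j) (pc, R) = (Suc pc, R(i := R j div 2))"
| "exec x (Load i j) (pc, R) = (Suc pc, R(i := R (R j)))"
| "exec x (Store i j) (pc, R) = (Suc pc, R(R i := R j))"
| "exec x (Read i j) (pc, R) = (Suc pc, R(i := (if R j < length x then x ! R j else 0)))"
| "exec x (Jump a) (pc, R) = (a, R)"
| "exec x (JumpZero i a) (pc, R) = (if R i = 0 then a else Suc pc, R)"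

text \<open>The machine has halted when the program counter is outside the program.\<close>

definition step :: "instr list \<Rightarrow> nat list \<Rightarrow> config \<Rightarrow> config" where
  "step P x cf = (if fst cf < length P then exec x (P ! fst cf) cf else cf)"

definition outputs_within :: "instr list \<Rightarrow> nat list \<Rightarrow> nat \<Rightarrow> nat \<Rightarrow> bool" where
  "outputs_within P x y t \<longleftrightarrow>
     (\<exists>pc R. (step P x ^^ t) (0, \<lambda>_. 0) = (pc, R) \<and> length P \<le> pc \<and> R 0 = y)"

definition computable :: "(nat \<Rightarrow> nat) \<Rightarrow> bool" where
  "computable f \<longleftrightarrow> (\<exists>P. \<forall>n. \<exists>t. outputs_within P [n] (f n) t)"


section \<open>Fixed-parameter tractability\<close>

text \<open>Length in bits, with one separating symbol per number.\<close>

definition input_size :: "nat list \<Rightarrow> nat" where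
  "input_size x = (\<Sum>a\<leftarrow>x. Suc (floorlog 2 a))"

text \<open>\<open>I\<close> is the set of admissible instances, \<open>enc\<close> their encoding, \<open>\<kappa>\<close> the parameter and
  \<open>yes\<close> the question. Nothing is required of the machine outside \<open>I\<close>.\<close>

definition fixed_parameter_tractable ::
    "'i set \<Rightarrow> ('i \<Rightarrow> nat list) \<Rightarrow> ('i \<Rightarrow> nat) \<Rightarrow> ('i \<Rightarrow> bool) \<Rightarrow> bool" where
  "fixed_parameter_tractable I enc \<kappa> yes \<longleftrightarrow>
     (\<exists>P f c. computable f \<and>
        (\<forall>x\<in>I. outputs_within P (enc x) (if yes x then 1 else 0)
                  (f (\<kappa> x) * input_size (enc x) ^ c)))"


section \<open>The matching problems\<close>

type_synonym graph_instance = "nat sgraph \<times> nat"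

text \<open>As usual, input graphs have vertex set \<open>{0, \<dots>, n - 1}\<close>, and are given by \<open>n\<close> and
  their adjacency matrix, row by row.\<close>

definition instances :: "nat sgraph set \<Rightarrow> graph_instance set" where
  "instances \<H> = {(G, k). G \<in> \<H> \<and> (\<exists>n. verts G = {..<n}) \<and> k > 0}"

definition encode :: "graph_instance \<Rightarrow> nat list" where
  "encode = (\<lambda>(G, k). let n = card (verts G) in
     n # k # concat (map (\<lambda>i. map (\<lambda>j. if {i, j} \<in> edges G then 1 else 0) [0..<n]) [0..<n]))"

definition parameter :: "graph_instance \<Rightarrow> nat" where
  "parameter = (\<lambda>(G, k). k)"

definition acyclic_matching_problem :: "graph_instance \<Rightarrow> bool" where
  "acyclic_matching_problem = (\<lambda>(G, k). \<exists>M. acyclic_matching G M \<and> card M = k)"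

definition induced_matching_problem :: "graph_instance \<Rightarrow> bool" where
  "induced_matching_problem = (\<lambda>(G, k). \<exists>M. induced_matching G M \<and> card M = k)"

end

theory Submission
  imports Defs
begin

text \<open>A proper minor-closed class excludes a clique, so by Mader's theorem its graphs have fewer than
  \<open>d\<close> times as many edges as vertices, for a constant \<open>d\<close>. Hence a matching of size \<open>4 d k\<close> contains
  an induced matching of size \<open>k\<close>, which is also an acyclic one. If there is no matching of that size,
  then some vertex cover has at most \<open>8 d k\<close> vertices, and the number of distinct neighbourhoods is
  bounded in terms of \<open>k\<close>.

  A graph has an acyclic (induced) matching of size \<open>k\<close> iff there are \<open>k\<close> edges, listed such that
  each has at most one (no) edge to its predecessors. This property only depends on the adjacencies
  between the listed vertices, so each vertex can be replaced by a fixed representative of the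
  vertices with the same neighbourhood. The machine collects the representatives, accepts if there
  are too many of them, and tries all sequences of representatives; the sequences are coded by the
  bits of a number below a doubly exponential bound in \<open>k\<close>.\<close>

section \<open>Sparsity of proper minor-closed classes\<close>

text \<open>Both problems become one question about \<open>good\<close> lists, with allowance
  \<open>r\<close> equal to 1 or 0. The value 1 comes from averaging: the 2m vertices of an acyclic
  matching of size m span fewer than 2m edges, so the two ends of some matching edge have degrees
  summing to less than 4, of which the edge itself takes 2. Twins may be replaced although distinct
  vertices might receive the same representative: \<open>good\<close> never asks for distinctness,
  which for \<open>r \<le> 1\<close> follows from the adjacency counts alone. The other obstacle is
  the concrete machine. It cannot multiply, and the structured programs used here branch only by
  loops that test for zero. Therefore loops count down, violations are added up in a register, and a
  vertex is selected in unary, by the number of ones in a block of bits; every number is then a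
  legal code. The search range depends only on the parameter and on a constant of the class. The
  search runs even if there are too many representatives: whatever it finds is genuine, and it has
  to be complete only when they are few.\<close>

lemma simple_graph_edgeE:
  assumes "simple_graph G" "e \<in> edges G"
  obtains u v where "u \<in> verts G" "v \<in> verts G" "u \<noteq> v" "e = {u, v}"
  using assms unfolding simple_graph_def by blast

lemma simple_graph_edge_subset: "simple_graph G \<Longrightarrow> e \<in> edges G \<Longrightarrow> e \<subseteq> verts G"
  by (elim simple_graph_edgeE) auto

lemma simple_graph_edgeD:
  assumes "simple_graph G" "{u, v} \<in> edges G"
  shows "u \<noteq> v" "u \<in> verts G" "v \<in> verts G"
  using assms by (auto elim!: simple_graph_edgeE simp: doubleton_eq_iff)

lemma simple_graph_finite:
  assumes "simple_graph G"
  shows "finite (verts G)" "finite (edges G)"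
proof -
  show *: "finite (verts G)" using assms by (simp add: simple_graph_def)
  show "finite (edges G)"
    using simple_graph_edge_subset[OF assms] by (intro finite_subset[OF _ finite_Pow_iff[THEN iffD2, OF *]]) auto
qed

lemma simple_graph_induced: "simple_graph G \<Longrightarrow> simple_graph (induced_subgraph G S)"
  unfolding simple_graph_def induced_subgraph_def by fastforce

lemma simple_graph_delete_vertex: "simple_graph G \<Longrightarrow> simple_graph (delete_vertex G v)"
  unfolding simple_graph_def delete_vertex_def by fastforce

lemma simple_graph_delete_edge: "simple_graph G \<Longrightarrow> simple_graph (delete_edge G e)"
  unfolding simple_graph_def delete_edge_def by simp

lemma simple_graph_contract_edge:
  assumes "simple_graph G" "{u, v} \<in> edges G"
  shows "simple_graph (contract_edge G u v)"
proof -
  have "finite (verts (contract_edge G u v))"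
    using simple_graph_finite[OF assms(1)] by (simp add: contract_edge_def)
  moreover have "\<exists>a b. a \<in> verts (contract_edge G u v) \<and> b \<in> verts (contract_edge G u v) \<and> a \<noteq> b \<and> e = {a, b}"
    if e: "e \<in> edges (contract_edge G u v)" for e
  proof -
    obtain f where f: "f \<in> edges G" "e = (\<lambda>x. if x = v then u else x) ` f" "e \<noteq> {u}"
      using e by (auto simp: contract_edge_def)
    obtain a b where ab: "a \<in> verts G" "b \<in> verts G" "a \<noteq> b" "f = {a, b}"
      using simple_graph_edgeE[OF assms(1) f(1)] .
    have uv: "u \<noteq> v" "u \<in> verts G" using simple_graph_edgeD[OF assms] by auto
    define \<sigma> where "\<sigma> = (\<lambda>x. if x = v then u else x)"
    have \<sigma>: "\<sigma> x \<in> verts (contract_edge G u v)" if "x \<in> verts G" for x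
      using that uv by (simp add: \<sigma>_def contract_edge_def)
    have e': "e = {\<sigma> a, \<sigma> b}" using f(2) ab(4) by (simp add: \<sigma>_def)
    moreover have "\<sigma> a \<noteq> \<sigma> b"
    proof
      assume eq: "\<sigma> a = \<sigma> b"
      then have "\<sigma> a = u" using ab(3) unfolding \<sigma>_def by metis
      then show False using e' f(3) eq by simp
    qed
    ultimately show ?thesis using \<sigma>[OF ab(1)] \<sigma>[OF ab(2)] by blast
  qed
  ultimately show ?thesis unfolding simple_graph_def by blast
qed

lemma simple_graph_isomorphic:
  assumes "simple_graph G" "isomorphic G H"
  shows "simple_graph H"
proof -
  obtain \<phi> where \<phi>: "bij_betw \<phi> (verts G) (verts H)" "edges H = (\<lambda>e. \<phi> ` e) ` edges G"
    using assms(2) by (auto simp: isomorphic_def)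
  have "finite (verts H)" using \<phi>(1) assms(1) bij_betw_finite by (auto simp: simple_graph_def)
  moreover have "\<exists>u v. u \<in> verts H \<and> v \<in> verts H \<and> u \<noteq> v \<and> e = {u, v}" if e: "e \<in> edges H" for e
  proof -
    obtain f where f: "f \<in> edges G" "e = \<phi> ` f" using e \<phi>(2) by auto
    obtain a b where ab: "a \<in> verts G" "b \<in> verts G" "a \<noteq> b" "f = {a, b}"
      using simple_graph_edgeE[OF assms(1) f(1)] .
    then show ?thesis
      using \<phi>(1) f(2) unfolding bij_betw_def inj_on_def by (intro exI[of _ "\<phi> a"] exI[of _ "\<phi> b"]) auto
  qed
  ultimately show ?thesis by (simp add: simple_graph_def)
qed

section \<open>Neighbourhoods and the degree sum\<close>

definition nbrs :: "'a sgraph \<Rightarrow> 'a \<Rightarrow> 'a set" where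
  "nbrs G v = {w. {v, w} \<in> edges G}"

lemma nbrs_subset: "simple_graph G \<Longrightarrow> nbrs G v \<subseteq> verts G"
  by (auto simp: nbrs_def dest: simple_graph_edgeD)

lemma finite_nbrs: "simple_graph G \<Longrightarrow> finite (nbrs G v)"
  using nbrs_subset simple_graph_finite finite_subset by metis

lemma card_nbrs:
  assumes "simple_graph G"
  shows "card (nbrs G v) = card {e \<in> edges G. v \<in> e}"
proof (rule bij_betw_same_card[of "\<lambda>w. {v, w}"], rule bij_betw_imageI)
  show "inj_on (\<lambda>w. {v, w}) (nbrs G v)" by (auto simp: inj_on_def doubleton_eq_iff)
  show "(\<lambda>w. {v, w}) ` nbrs G v = {e \<in> edges G. v \<in> e}"
  proof (intro equalityI subsetI)
    fix e assume e: "e \<in> {e \<in> edges G. v \<in> e}"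
    then obtain a b where "e = {a, b}" using simple_graph_edgeE[OF assms] by blast
    then show "e \<in> (\<lambda>w. {v, w}) ` nbrs G v" using e by (auto simp: nbrs_def insert_commute)
  qed (auto simp: nbrs_def)
qed

lemma handshake:
  assumes "simple_graph G"
  shows "(\<Sum>v\<in>verts G. card (nbrs G v)) = 2 * card (edges G)"
proof -
  have "card {v \<in> verts G. v \<in> e} = 2" if e: "e \<in> edges G" for e
  proof -
    have "{v \<in> verts G. v \<in> e} = e" using simple_graph_edge_subset[OF assms e] by auto
    then show ?thesis using e assms by (auto elim!: simple_graph_edgeE)
  qed
  then have "(\<Sum>v\<in>verts G. card {e \<in> edges G. v \<in> e}) = 2 * card (edges G)"
    using simple_graph_finite[OF assms] by (intro sum_multicount) auto
  then show ?thesis by (simp add: card_nbrs[OF assms])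
qed

text \<open>Simplicity and closure under single operations are all that the density argument uses,
  and they pass to links one operation at a time, with no induction over
  \<open>has_minor\<close>.\<close>

definition minor_steps_closed :: "nat sgraph set \<Rightarrow> bool" where
  "minor_steps_closed \<H> \<longleftrightarrow> (\<forall>G\<in>\<H>. simple_graph G \<and>
     (\<forall>G'. isomorphic G G' \<longrightarrow> G' \<in> \<H>) \<and>
     (\<forall>v\<in>verts G. delete_vertex G v \<in> \<H>) \<and>
     (\<forall>e\<in>edges G. delete_edge G e \<in> \<H>) \<and>
     (\<forall>u v. {u, v} \<in> edges G \<longrightarrow> contract_edge G u v \<in> \<H>))"

lemma minor_steps_closedI:
  assumes "graph_class \<H>" "minor_closed \<H>"
  shows "minor_steps_closed \<H>"
proof -
  have 1: "simple_graph G" if "G \<in> \<H>" for G using assms(1) that by (simp add: graph_class_def)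
  have 2: "G' \<in> \<H>" if "G \<in> \<H>" "has_minor G G'" for G G'
    using assms(2) that by (auto simp: minor_closed_def)
  show ?thesis
    unfolding minor_steps_closed_def
  proof (intro ballI conjI allI impI)
    fix G assume G: "G \<in> \<H>"
    note r = has_minor.refl[of G]
    show "simple_graph G" by (rule 1[OF G])
    show "G' \<in> \<H>" if "isomorphic G G'" for G'
      by (rule 2[OF G has_minor.iso[OF r that]])
    show "delete_vertex G v \<in> \<H>" if "v \<in> verts G" for v
      by (rule 2[OF G has_minor.delete_vertex[OF r that]])
    show "delete_edge G e \<in> \<H>" if "e \<in> edges G" for e
      by (rule 2[OF G has_minor.delete_edge[OF r that]])
    show "contract_edge G u v \<in> \<H>" if "{u, v} \<in> edges G" for u v
      by (rule 2[OF G has_minor.contract_edge[OF r that simple_graph_edgeD(1)[OF 1[OF G] that]]])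
  qed
qed

lemma induced_subgraph_closed:
  assumes "minor_steps_closed \<H>" "G \<in> \<H>"
  shows "induced_subgraph G S \<in> \<H>"
proof -
  have G: "simple_graph G" using assms by (simp add: minor_steps_closed_def)
  have *: "induced_subgraph G (- D) \<in> \<H>" if "finite D" "D \<subseteq> verts G" for D
    using that
  proof (induction D rule: finite_induct)
    case empty
    have "induced_subgraph G (- {}) = G" by (simp add: induced_subgraph_def)
    then show ?case using assms(2) by simp
  next
    case (insert v D)
    have "v \<in> verts (induced_subgraph G (- D))"
      using insert by (auto simp: induced_subgraph_def)
    moreover have "delete_vertex (induced_subgraph G (- D)) v = induced_subgraph G (- insert v D)"
      by (auto simp: delete_vertex_def induced_subgraph_def)
    ultimately show ?case
      using insert assms(1) unfolding minor_steps_closed_def by (metis insert_subset)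
  qed
  have "induced_subgraph G S = induced_subgraph G (- (verts G - S))"
    using simple_graph_edge_subset[OF G] by (auto simp: induced_subgraph_def)
  then show ?thesis using *[of "verts G - S"] simple_graph_finite[OF G] by simp
qed

section \<open>Cones, links and the minor operations\<close>

definition complete_on :: "'a set \<Rightarrow> 'a sgraph" where
  "complete_on V = \<lparr>verts = V, edges = {{u, v} | u v. u \<in> V \<and> v \<in> V \<and> u \<noteq> v}\<rparr>"

definition apex :: "'a sgraph \<Rightarrow> 'a \<Rightarrow> 'a sgraph" where
  "apex G v = \<lparr>verts = insert v (verts G), edges = edges G \<union> (\<lambda>w. {v, w}) ` verts G\<rparr>"

lemma apex_delete_vertex:
  assumes "v \<notin> verts G" "w \<in> verts G"
  shows "delete_vertex (apex G v) w = apex (delete_vertex G w) v"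
  using assms by (auto simp: delete_vertex_def apex_def)

lemma apex_delete_edge:
  assumes "simple_graph G" "v \<notin> verts G" "e \<in> edges G"
  shows "delete_edge (apex G v) e = apex (delete_edge G e) v"
  using assms simple_graph_edge_subset[OF assms(1,3)] by (auto simp: delete_edge_def apex_def)

text \<open>The apex differs from both ends of the contracted edge, so its edges to \<open>u\<close>
  and \<open>w\<close> merge into its edge to \<open>u\<close>, and no cone edge turns into the loop
  that is removed.\<close>

lemma apex_contract_edge:
  assumes "simple_graph G" "v \<notin> verts G" "{u, w} \<in> edges G"
  shows "contract_edge (apex G v) u w = apex (contract_edge G u w) v"
proof -
  let ?\<sigma> = "\<lambda>x. if x = w then u else x"
  note uw = simple_graph_edgeD[OF assms(1,3)]
  have "(\<lambda>e. ?\<sigma> ` e) ` (\<lambda>x. {v, x}) ` verts G = (\<lambda>x. {v, x}) ` (verts G - {w})"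
  proof -
    have "(\<lambda>e. ?\<sigma> ` e) ` (\<lambda>x. {v, x}) ` verts G = (\<lambda>x. {v, x}) ` ?\<sigma> ` verts G"
      unfolding image_image using assms(2) uw by (intro image_cong) auto
    moreover have "?\<sigma> ` verts G = verts G - {w}" using uw by auto
    ultimately show ?thesis by simp
  qed
  moreover have "{u} \<notin> (\<lambda>x. {v, x}) ` (verts G - {w})" using assms(2) uw by auto
  ultimately show ?thesis
    using assms(2) uw by (auto simp: contract_edge_def apex_def image_Un Un_Diff)
qed

lemma apex_isomorphic:
  assumes G: "simple_graph G" and v: "v \<notin> verts G" "v' \<notin> verts G'" and iso: "isomorphic G G'"
  shows "isomorphic (apex G v) (apex G' v')"
proof -
  obtain \<phi> where \<phi>: "bij_betw \<phi> (verts G) (verts G')" "edges G' = (\<lambda>e. \<phi> ` e) ` edges G"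
    using iso by (auto simp: isomorphic_def)
  let ?\<psi> = "\<phi>(v := v')"
  have eq: "?\<psi> ` e = \<phi> ` e" if "e \<subseteq> verts G" for e using that v by (intro image_cong) auto
  have "bij_betw ?\<psi> (verts G) (verts G')"
    using \<phi>(1) v(1) bij_betw_cong[of "verts G" \<phi> ?\<psi>] by (metis fun_upd_other)
  then have "bij_betw ?\<psi> (insert v (verts G)) (insert v' (verts G'))"
    using bij_betw_combine[of ?\<psi> "verts G" "verts G'" "{v}" "{v'}"] v by simp
  moreover have "(\<lambda>e. ?\<psi> ` e) ` edges G = edges G'"
    unfolding \<phi>(2) using eq[OF simple_graph_edge_subset[OF G]] by (rule image_cong[OF HOL.refl])
  moreover have "(\<lambda>e. ?\<psi> ` e) ` (\<lambda>w. {v, w}) ` verts G = (\<lambda>w. {v', w}) ` verts G'"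
  proof -
    have "(\<lambda>e. ?\<psi> ` e) ` (\<lambda>w. {v, w}) ` verts G = (\<lambda>w. {v', w}) ` \<phi> ` verts G"
      unfolding image_image using v by (intro image_cong) auto
    then show ?thesis using \<phi>(1) by (simp add: bij_betw_def)
  qed
  ultimately show ?thesis
    unfolding isomorphic_def apex_def sgraph.simps image_Un by metis
qed

text \<open>The neighbourhood of a vertex of a graph in \<open>\<H>\<close> induces a graph in this class.\<close>

definition link_class :: "nat sgraph set \<Rightarrow> nat sgraph set" where
  "link_class \<H> = {G. simple_graph G \<and> (\<exists>v. v \<notin> verts G \<and> apex G v \<in> \<H>)}"

lemma link_class_closed:
  assumes "minor_steps_closed \<H>"
  shows "minor_steps_closed (link_class \<H>)"
  unfolding minor_steps_closed_def
proof (rule ballI)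
  fix G assume "G \<in> link_class \<H>"
  then obtain v where G: "simple_graph G" and v: "v \<notin> verts G" and A: "apex G v \<in> \<H>"
    by (auto simp: link_class_def)
  have 1: "G' \<in> link_class \<H>" if iso: "isomorphic G G'" for G'
  proof -
    have s: "simple_graph G'" using simple_graph_isomorphic[OF G iso] .
    \<comment> \<open>The old apex may be a vertex of the copy \<open>G'\<close>, so a new one is
      chosen; the vertex type is infinite.\<close>
    obtain v' where v': "v' \<notin> verts G'"
      using ex_new_if_finite[OF infinite_UNIV_nat simple_graph_finite(1)[OF s]] by blast
    then show ?thesis
      using s A apex_isomorphic[OF G v v' iso] assms
      by (auto simp: link_class_def minor_steps_closed_def)
  qed
  have 2: "delete_vertex G w \<in> link_class \<H>" if w: "w \<in> verts G" for w
  proof -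
    have "delete_vertex (apex G v) w \<in> \<H>"
      using A assms that by (simp add: minor_steps_closed_def apex_def)
    then show ?thesis
      using apex_delete_vertex[OF v w] simple_graph_delete_vertex[OF G] v
      by (auto simp: link_class_def delete_vertex_def)
  qed
  have 3: "delete_edge G e \<in> link_class \<H>" if e: "e \<in> edges G" for e
  proof -
    have "delete_edge (apex G v) e \<in> \<H>"
      using A assms that by (simp add: minor_steps_closed_def apex_def)
    then show ?thesis
      using apex_delete_edge[OF G v e] simple_graph_delete_edge[OF G] v
      by (auto simp: link_class_def delete_edge_def)
  qed
  have 4: "contract_edge G u w \<in> link_class \<H>" if e: "{u, w} \<in> edges G" for u w
  proof -
    have "contract_edge (apex G v) u w \<in> \<H>"
      using A assms that by (simp add: minor_steps_closed_def apex_def)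
    then show ?thesis
      using apex_contract_edge[OF G v e] simple_graph_contract_edge[OF G e] v
      by (auto simp: link_class_def contract_edge_def)
  qed
  show "simple_graph G \<and> (\<forall>G'. isomorphic G G' \<longrightarrow> G' \<in> link_class \<H>) \<and>
    (\<forall>v\<in>verts G. delete_vertex G v \<in> link_class \<H>) \<and>
    (\<forall>e\<in>edges G. delete_edge G e \<in> link_class \<H>) \<and>
    (\<forall>u v. {u, v} \<in> edges G \<longrightarrow> contract_edge G u v \<in> link_class \<H>)"
    using G 1 2 3 4 by blast
qed

text \<open>Set aside \<open>{u, v}\<close> and the edges from \<open>v\<close> to common
  neighbours. On the remaining edges the renaming of \<open>v\<close> to \<open>u\<close> is
  injective: an edge at \<open>v\<close> goes to some \<open>{u, b}\<close> that was not an edge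
  before, and all others stay fixed.\<close>

lemma card_edges_contract:
  assumes G: "simple_graph G" and e: "{u, v} \<in> edges G"
  shows "card (edges G) \<le> card (edges (contract_edge G u v)) + 1 + card (nbrs G u \<inter> nbrs G v)"
    and "card (edges (contract_edge G u v)) \<le> card (edges G)"
proof -
  let ?\<sigma> = "\<lambda>x. if x = v then u else x"
  let ?C = "(\<lambda>w. {v, w}) ` (nbrs G u \<inter> nbrs G v)"
  let ?E = "edges G - {{u, v}} - ?C"
  note fin = simple_graph_finite[OF G]
  have uv: "u \<noteq> v" using simple_graph_edgeD[OF G e] by simp
  have off: "?\<sigma> ` e = e" if "v \<notin> e" for e
  proof -
    have "?\<sigma> ` e = id ` e" using that by (intro image_cong) auto
    then show ?thesis by simp
  qed
  have on: "\<exists>b. e = {v, b} \<and> b \<noteq> u \<and> ?\<sigma> ` e = {u, b} \<and> {u, b} \<notin> edges G"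
    if e: "e \<in> ?E" and v: "v \<in> e" for e
  proof -
    have "e \<in> edges G" using e by simp
    from simple_graph_edgeE[OF G this] obtain b where b: "b \<noteq> v" "e = {v, b}"
      using v by (metis insertE insert_commute singletonD)
    have bu: "b \<noteq> u" using e b(2) by (auto simp: insert_commute)
    have "{u, b} \<notin> edges G"
    proof
      assume "{u, b} \<in> edges G"
      then have "b \<in> nbrs G u \<inter> nbrs G v" using \<open>e \<in> edges G\<close> b(2) by (simp add: nbrs_def)
      then have "e \<in> ?C" using b(2) by blast
      then show False using e by blast
    qed
    moreover have "?\<sigma> ` e = {u, b}" using b by auto
    ultimately show ?thesis using b(2) bu by blast
  qed
  have inj: "inj_on (\<lambda>e. ?\<sigma> ` e) ?E"
  proof (rule inj_onI)
    fix e f assume e: "e \<in> ?E" and f: "f \<in> ?E" and eq: "?\<sigma> ` e = ?\<sigma> ` f"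
    have E: "e \<in> edges G" "f \<in> edges G" using e f by auto
    show "e = f"
    proof (cases "v \<in> e"; cases "v \<in> f")
      assume "v \<in> e" "v \<in> f"
      from on[OF e this(1)] on[OF f this(2)] eq show ?thesis by (metis doubleton_eq_iff)
    next
      assume "v \<in> e" "v \<notin> f"
      from on[OF e this(1)] off[OF this(2)] eq E show ?thesis by metis
    next
      assume "v \<notin> e" "v \<in> f"
      from on[OF f this(2)] off[OF this(1)] eq E show ?thesis by metis
    next
      assume "v \<notin> e" "v \<notin> f"
      from off[OF this(1)] off[OF this(2)] eq show ?thesis by simp
    qed
  qed
  have sub: "(\<lambda>e. ?\<sigma> ` e) ` ?E \<subseteq> edges (contract_edge G u v)"
  proof -
    have "?\<sigma> ` e \<noteq> {u}" if "e \<in> ?E" for e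
    proof -
      have "?\<sigma> ` e = {u} \<Longrightarrow> v \<notin> e" using on[OF that] by fastforce
      moreover have "e \<noteq> {u}" using that simple_graph_edgeD(1)[OF G, of u u] by auto
      ultimately show ?thesis using off[of e] by metis
    qed
    then show ?thesis by (auto simp: contract_edge_def)
  qed
  have finC: "finite (edges (contract_edge G u v))" using fin by (simp add: contract_edge_def)
  have "card ?E \<le> card (edges (contract_edge G u v))"
    using card_inj_on_le[OF inj sub finC] .
  moreover have "card (edges G) \<le> card ({{u, v}} \<union> ?C \<union> ?E)"
    using fin finite_nbrs[OF G] by (intro card_mono) auto
  moreover have "card ({{u, v}} \<union> ?C \<union> ?E) \<le> card ({{u, v}} \<union> ?C) + card ?E" by (rule card_Un_le)
  moreover have "card ({{u, v}} \<union> ?C) \<le> 1 + card ?C" using card_Un_le[of "{{u, v}}" ?C] by simp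
  moreover have "card ?C \<le> card (nbrs G u \<inter> nbrs G v)"
    using finite_nbrs[OF G] by (intro card_image_le) simp
  ultimately show "card (edges G) \<le> card (edges (contract_edge G u v)) + 1 + card (nbrs G u \<inter> nbrs G v)"
    by linarith
  have "card (edges (contract_edge G u v)) \<le> card ((\<lambda>e. ?\<sigma> ` e) ` edges G)"
    using fin by (intro card_mono) (auto simp: contract_edge_def)
  also have "\<dots> \<le> card (edges G)" using fin by (intro card_image_le)
  finally show "card (edges (contract_edge G u v)) \<le> card (edges G)" .
qed

text \<open>Mader's argument: in a minimal dense graph of the class every edge lies in many triangles, so
  the neighbourhood of a vertex is dense, and it belongs to a class excluding a smaller clique.\<close>

theorem edges_lt_of_no_complete:
  assumes "minor_steps_closed \<H>"
    and "\<And>V. finite V \<Longrightarrow> card V = h \<Longrightarrow> complete_on V \<notin> \<H>"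
    and "G \<in> \<H>" "verts G \<noteq> {}"
  shows "card (edges G) < 2 ^ h * card (verts G)"
  using assms
proof (induction h arbitrary: \<H> G)
  \<comment> \<open>The clique on no vertices is the subgraph induced on the empty set, so the class
    cannot exclude it.\<close>
  case 0
  have "simple_graph G" using 0 by (simp add: minor_steps_closed_def)
  then have "{} \<notin> edges G" by (auto elim: simple_graph_edgeE)
  then have "induced_subgraph G {} = complete_on {}"
    by (auto simp: induced_subgraph_def complete_on_def)
  then show ?case using induced_subgraph_closed[OF 0(1,3), of "{}"] 0(2)[of "{}"] by simp
next
  case (Suc h)
  note cl = Suc.prems(1) and noK = Suc.prems(2)
  show ?case
    using Suc.prems(3,4)
  \<comment> \<open>Contraction removes one vertex and adds no edge, so this measure drops; a
    counterexample may be taken minimal.\<close>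
  proof (induction "card (verts G) + card (edges G)" arbitrary: G rule: less_induct)
    case (less G)
    have G: "simple_graph G" using less.prems cl by (simp add: minor_steps_closed_def)
    note fin = simple_graph_finite[OF G]
    show ?case
    proof (rule ccontr)
      assume "\<not> ?thesis"
      then have dense: "2 ^ Suc h * card (verts G) \<le> card (edges G)" by simp
      \<comment> \<open>The contracted graph obeys the bound with one vertex less, so contracting
        loses more than \<open>2 ^ Suc h\<close> edges. Apart from \<open>{u, v}\<close> these are
        accounted for by common neighbours.\<close>
      have common: "2 ^ Suc h \<le> card (nbrs G u \<inter> nbrs G v)" if e: "{u, v} \<in> edges G" for u v
      proof -
        let ?G = "contract_edge G u v"
        note uv = simple_graph_edgeD[OF G e]
        have V: "verts ?G = verts G - {v}" by (simp add: contract_edge_def)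
        have cV: "card (verts G) = Suc (card (verts ?G))"
          unfolding V using fin uv card.remove[of "verts G" v] by simp
        have "?G \<in> \<H>" using less.prems cl e by (simp add: minor_steps_closed_def)
        moreover have "verts ?G \<noteq> {}" using uv V by blast
        moreover have "card (verts ?G) + card (edges ?G) < card (verts G) + card (edges G)"
          using cV card_edges_contract(2)[OF G e] by simp
        ultimately have "card (edges ?G) < 2 ^ Suc h * card (verts ?G)"
          using less.hyps by blast
        then show ?thesis using card_edges_contract(1)[OF G e] dense cV by simp
      qed
      have "card (verts G) > 0" using less.prems fin by (simp add: card_gt_0_iff)
      then have "card (edges G) > 0" using dense by (metis le_zero_eq mult_is_0 not_gr_zero power_eq_0_iff zero_neq_numeral)
      then obtain e where "e \<in> edges G" by (auto simp: card_gt_0_iff)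
      then obtain v w where vw: "{v, w} \<in> edges G" using simple_graph_edgeE[OF G] by metis
      let ?N = "nbrs G v"
      let ?L = "induced_subgraph G ?N"
      have L: "simple_graph ?L" by (rule simple_graph_induced[OF G])
      have vN: "v \<notin> ?N" using simple_graph_edgeD(1)[OF G, of v v] by (auto simp: nbrs_def)
      have VL: "verts ?L = ?N" using nbrs_subset[OF G] by (auto simp: induced_subgraph_def)
      have vV: "v \<in> verts G" using simple_graph_edgeD[OF G vw] by simp
      \<comment> \<open>Since \<open>v\<close> is joined to its whole neighbourhood, the cone over
        the link is an induced subgraph and hence in the class.\<close>
      have "apex ?L v = induced_subgraph G (insert v ?N)"
      proof -
        have "{e \<in> edges G. e \<subseteq> ?N} \<union> (\<lambda>w. {v, w}) ` ?N = {e \<in> edges G. e \<subseteq> insert v ?N}"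
        proof (intro equalityI subsetI)
          fix e assume e: "e \<in> {e \<in> edges G. e \<subseteq> insert v ?N}"
          then have "e \<in> edges G" by simp
          from simple_graph_edgeE[OF G this] obtain a b where "a \<noteq> b" "e = {a, b}" by metis
          then show "e \<in> {e \<in> edges G. e \<subseteq> ?N} \<union> (\<lambda>w. {v, w}) ` ?N"
            using e by (auto simp: insert_commute)
        qed (auto simp: nbrs_def)
        moreover have "insert v (verts G \<inter> ?N) = verts G \<inter> insert v ?N" using vV by auto
        moreover have "verts G \<inter> ?N = ?N" using nbrs_subset[OF G] by auto
        ultimately show ?thesis by (simp add: apex_def induced_subgraph_def)
      qed
      then have "?L \<in> link_class \<H>"
        using L vN VL induced_subgraph_closed[OF cl less.prems(1), of "insert v ?N"]
        unfolding link_class_def by auto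
      moreover have "complete_on V \<notin> link_class \<H>" if V: "finite V" "card V = h" for V
      proof
        assume "complete_on V \<in> link_class \<H>"
        then obtain z where z: "z \<notin> V" "apex (complete_on V) z \<in> \<H>"
          by (auto simp: link_class_def complete_on_def)
        have "apex (complete_on V) z = complete_on (insert z V)"
          using z(1) by (auto simp: apex_def complete_on_def doubleton_eq_iff)
        then show False using noK[of "insert z V"] V z by simp
      qed
      moreover have "verts ?L \<noteq> {}" using vw VL by (auto simp: nbrs_def)
      ultimately have less: "card (edges ?L) < 2 ^ h * card ?N"
        using Suc.IH[OF link_class_closed[OF cl]] VL by metis
      \<comment> \<open>Common neighbours of \<open>v\<close> and \<open>w\<close> are neighbours of
        \<open>w\<close> inside the link. Minimum degree \<open>2 ^ Suc h\<close> yields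
        \<open>2 ^ h\<close> edges per vertex; this halving is why the constant doubles with
        \<open>h\<close>.\<close>
      have "2 ^ Suc h \<le> card (nbrs ?L w)" if w: "w \<in> ?N" for w
      proof -
        have "nbrs G v \<inter> nbrs G w \<subseteq> nbrs ?L w"
          using w by (auto simp: nbrs_def induced_subgraph_def)
        then have "card (nbrs G v \<inter> nbrs G w) \<le> card (nbrs ?L w)"
          using finite_nbrs[OF L] by (intro card_mono)
        then show ?thesis using common[of v w] w by (simp add: nbrs_def)
      qed
      then have "card ?N * 2 ^ Suc h \<le> (\<Sum>w\<in>?N. card (nbrs ?L w))"
        using sum_bounded_below[of ?N "2 ^ Suc h" "\<lambda>w. card (nbrs ?L w)"] by simp
      also have "\<dots> = 2 * card (edges ?L)" using handshake[OF L] VL by simp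
      finally show False using less by (simp add: mult.commute)
    qed
  qed
qed

text \<open>An excluded graph \<open>X\<close> arises by edge deletions from the clique on its
  vertices, so that clique is excluded, and with it all isomorphic ones. This gives the constant
  \<open>2 ^ card (verts X)\<close>.\<close>

corollary proper_minor_closed_sparse:
  assumes "graph_class \<H>" "minor_closed \<H>" "proper_class \<H>"
  obtains d where "d > 0"
    "\<And>G. G \<in> \<H> \<Longrightarrow> verts G \<noteq> {} \<Longrightarrow> card (edges G) < d * card (verts G)"
proof -
  note cl = minor_steps_closedI[OF assms(1,2)]
  obtain X where X: "simple_graph X" "X \<notin> \<H>" using assms(3) by (auto simp: proper_class_def)
  have noK: "complete_on (verts X) \<notin> \<H>"
  proof
    assume K: "complete_on (verts X) \<in> \<H>"
    let ?E = "edges (complete_on (verts X))"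
    have KX: "edges X \<subseteq> ?E" using X(1) by (auto simp: complete_on_def elim!: simple_graph_edgeE)
    have "\<lparr>verts = verts X, edges = ?E - D\<rparr> \<in> \<H>" if "finite D" "D \<subseteq> ?E" for D
      using that
    proof (induction D rule: finite_induct)
      case empty
      then show ?case using K by (simp add: complete_on_def)
    next
      case (insert e D)
      have "delete_edge \<lparr>verts = verts X, edges = ?E - D\<rparr> e = \<lparr>verts = verts X, edges = ?E - insert e D\<rparr>"
        by (auto simp: delete_edge_def)
      moreover have "delete_edge \<lparr>verts = verts X, edges = ?E - D\<rparr> e \<in> \<H>"
        using insert cl unfolding minor_steps_closed_def by auto
      ultimately show ?case by simp
    qed
    moreover have "simple_graph (complete_on (verts X))" using K cl by (simp add: minor_steps_closed_def)
    then have "finite ?E" by (rule simple_graph_finite)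
    ultimately have "\<lparr>verts = verts X, edges = ?E - (?E - edges X)\<rparr> \<in> \<H>" by blast
    moreover have "?E - (?E - edges X) = edges X" using KX by auto
    moreover have "\<lparr>verts = verts X, edges = edges X\<rparr> = X" by simp
    ultimately show False using X(2) by argo
  qed
  have "complete_on V \<notin> \<H>" if V: "finite V" "card V = card (verts X)" for V
  proof
    assume K: "complete_on V \<in> \<H>"
    obtain \<phi> where \<phi>: "bij_betw \<phi> V (verts X)"
      using finite_same_card_bij[OF V(1) simple_graph_finite(1)[OF X(1)] V(2)] by blast
    have "edges (complete_on (verts X)) = (\<lambda>e. \<phi> ` e) ` edges (complete_on V)"
    proof (intro equalityI subsetI)
      fix e assume "e \<in> edges (complete_on (verts X))"
      then obtain u v where "e = {u, v}" "u \<in> \<phi> ` V" "v \<in> \<phi> ` V" "u \<noteq> v"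
        using \<phi> by (auto simp: complete_on_def bij_betw_def)
      then obtain a b where ab: "e = \<phi> ` {a, b}" "a \<in> V" "b \<in> V" "a \<noteq> b" by auto
      then have "{a, b} \<in> edges (complete_on V)" by (auto simp: complete_on_def)
      then show "e \<in> (\<lambda>e. \<phi> ` e) ` edges (complete_on V)" using ab(1) by (rule image_eqI[rotated])
    next
      fix e assume "e \<in> (\<lambda>e. \<phi> ` e) ` edges (complete_on V)"
      then obtain a b where "e = \<phi> ` {a, b}" "a \<in> V" "b \<in> V" "a \<noteq> b" by (auto simp: complete_on_def)
      moreover from this have "\<phi> a \<in> verts X" "\<phi> b \<in> verts X" "\<phi> a \<noteq> \<phi> b"
        using bij_betwE[OF \<phi>] inj_onD[OF bij_betw_imp_inj_on[OF \<phi>], of a b] by auto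
      ultimately show "e \<in> edges (complete_on (verts X))" by (auto simp: complete_on_def)
    qed
    then have "isomorphic (complete_on V) (complete_on (verts X))"
      using \<phi> by (auto simp: isomorphic_def complete_on_def)
    then show False using noK K cl by (auto simp: minor_steps_closed_def)
  qed
  then show thesis
    using that[of "2 ^ card (verts X)"] edges_lt_of_no_complete[OF cl] by simp
qed

section \<open>Acyclic graphs\<close>

definition simple_path :: "'a sgraph \<Rightarrow> 'a list \<Rightarrow> bool" where
  "simple_path G p \<longleftrightarrow> p \<noteq> [] \<and> distinct p \<and> set p \<subseteq> verts G \<and>
     (\<forall>i. Suc i < length p \<longrightarrow> {p ! i, p ! Suc i} \<in> edges G)"

text \<open>Take the first vertex of a longest path. Its neighbours all lie on the path, and one
  other than its successor would close a cycle.\<close>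

lemma acyclic_exists_leaf:
  assumes G: "simple_graph G" and acyc: "acyclic_graph G" and ne: "verts G \<noteq> {}"
  shows "\<exists>v\<in>verts G. card (nbrs G v) \<le> 1"
proof -
  obtain v where v: "v \<in> verts G" using ne by blast
  have "simple_path G [v]" using v by (simp add: simple_path_def)
  moreover have "length p < Suc (card (verts G))" if "simple_path G p" for p
    using that simple_graph_finite(1)[OF G] unfolding simple_path_def
    by (metis card_mono distinct_card less_Suc_eq_le)
  ultimately obtain p where p: "simple_path G p" and max: "\<And>q. simple_path G q \<Longrightarrow> length q \<le> length p"
    using ex_has_greatest_nat[of "simple_path G" "[v]" length "Suc (card (verts G))"] by (metis less_imp_le)
  obtain x xs where px: "p = x # xs" using p by (cases p) (auto simp: simple_path_def)
  have x: "x \<in> verts G" using p px by (simp add: simple_path_def)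
  have in_p: "w \<in> set xs" if w: "{x, w} \<in> edges G" for w
  proof (rule ccontr)
    assume n: "w \<notin> set xs"
    have "w \<noteq> x" "w \<in> verts G" using simple_graph_edgeD[OF G w] by auto
    moreover have "{(w # p) ! i, (w # p) ! Suc i} \<in> edges G" if "Suc i < length (w # p)" for i
      using that p px w by (cases i) (auto simp: simple_path_def insert_commute)
    ultimately have "simple_path G (w # p)"
      using p px n unfolding simple_path_def by auto
    then show False using max by force
  qed
  have "card (nbrs G x) \<le> 1"
  proof (rule ccontr)
    assume "\<not> ?thesis"
    \<comment> \<open>\<open>xs ! 0\<close> is the successor of \<open>x\<close>. For empty
      \<open>xs\<close> it is unspecified, which does no harm: every neighbour of \<open>x\<close>
      lies in \<open>xs\<close>.\<close>
    then have "\<not> nbrs G x \<subseteq> {xs ! 0}"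
      using card_mono[of "{xs ! 0}" "nbrs G x"] by auto
    then obtain w where w: "{x, w} \<in> edges G" "w \<noteq> xs ! 0" by (auto simp: nbrs_def)
    obtain j where j: "j < length xs" "w = xs ! j" using in_p[OF w(1)] by (auto simp: in_set_conv_nth)
    then have j0: "j > 0" using w(2) by (cases j) auto
    \<comment> \<open>The path from \<open>x\<close> up to \<open>w\<close>: since \<open>x\<close>
      precedes \<open>xs\<close>, the entry \<open>xs ! j\<close> is the one at position
      \<open>Suc j\<close> of \<open>p\<close>.\<close>
    let ?c = "take (Suc (Suc j)) p"
    have len: "length ?c = Suc (Suc j)" using j px by simp
    have last: "last ?c = w" using j px len by (auto simp: last_conv_nth)
    have "is_cycle G ?c"
      unfolding is_cycle_def
    proof (intro conjI allI impI)
      show "3 \<le> length ?c" using len j0 by simp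
      show "distinct ?c" using p by (simp add: simple_path_def)
      show "set ?c \<subseteq> verts G" using p set_take_subset[of "Suc (Suc j)" p] by (auto simp: simple_path_def)
      show "{?c ! i, ?c ! Suc i} \<in> edges G" if "Suc i < length ?c" for i
        using that p by (auto simp: simple_path_def)
      show "{last ?c, hd ?c} \<in> edges G" using last w(1) px by (simp add: insert_commute)
    qed
    then show False using acyc by (auto simp: acyclic_graph_def)
  qed
  then show ?thesis using x by blast
qed

lemma acyclic_induced_mono:
  assumes "acyclic_graph (induced_subgraph G T)" "S \<subseteq> T"
  shows "acyclic_graph (induced_subgraph G S)"
proof -
  have "is_cycle (induced_subgraph G T) p" if "is_cycle (induced_subgraph G S) p" for p
    using that assms(2) by (auto simp: is_cycle_def induced_subgraph_def)
  then show ?thesis using assms(1) by (auto simp: acyclic_graph_def)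
qed

lemma acyclic_card_edges:
  assumes "simple_graph G" "acyclic_graph G" "verts G \<noteq> {}"
  shows "card (edges G) < card (verts G)"
  using assms
proof (induction "card (verts G)" arbitrary: G)
  case 0
  then show ?case using simple_graph_finite(1) by fastforce
next
  case (Suc n)
  note G = Suc.prems(1)
  note fin = simple_graph_finite[OF G]
  obtain v where v: "v \<in> verts G" "card (nbrs G v) \<le> 1"
    using acyclic_exists_leaf[OF Suc.prems] by blast
  let ?G = "induced_subgraph G (- {v})"
  have V: "verts ?G = verts G - {v}" by (auto simp: induced_subgraph_def)
  have E: "edges G = edges ?G \<union> {e \<in> edges G. v \<in> e}" by (auto simp: induced_subgraph_def)
  have "card (edges G) \<le> card (edges ?G) + card {e \<in> edges G. v \<in> e}"
    using card_Un_le[of "edges ?G" "{e \<in> edges G. v \<in> e}"] by (subst E)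
  then have le: "card (edges G) \<le> card (edges ?G) + card (nbrs G v)" by (simp add: card_nbrs[OF G])
  have cV: "card (verts ?G) = n" using Suc.hyps(2) v(1) fin V by simp
  show ?case
  proof (cases "verts ?G = {}")
    case True
    then have "verts G = {v}" using V v(1) by auto
    then have "e \<notin> edges G" for e using simple_graph_edgeE[OF G] by (metis singletonD)
    then have "edges G = {}" by blast
    then show ?thesis using \<open>verts G = {v}\<close> by simp
  next
    case False
    have "induced_subgraph G UNIV = G" by (simp add: induced_subgraph_def)
    then have "acyclic_graph (induced_subgraph G UNIV)" using Suc.prems(2) by metis
    then have "acyclic_graph ?G" using acyclic_induced_mono by blast
    then have "card (edges ?G) < card (verts ?G)"
      using Suc.hyps(1)[of ?G] cV simple_graph_induced[OF G] False by simp
    then show ?thesis using le v(2) cV Suc.hyps(2) by simp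
  qed
qed

lemma cycle_vertex_two_nbrs:
  assumes c: "is_cycle G p" and x: "x \<in> set p"
  obtains u w where "u \<noteq> w" "u \<in> set p" "w \<in> set p" "{x, u} \<in> edges G" "{x, w} \<in> edges G"
proof -
  let ?n = "length p"
  have n: "?n \<ge> 3" and d: "distinct p" using c by (auto simp: is_cycle_def)
  have e: "{p ! i, p ! (Suc i mod ?n)} \<in> edges G" if "i < ?n" for i
  proof (cases "Suc i < ?n")
    case True
    then show ?thesis using c by (simp add: is_cycle_def)
  next
    case False
    then have i: "Suc i = ?n" using that by simp
    have "p \<noteq> []" using n by auto
    then have "p ! i = last p" "p ! (Suc i mod ?n) = hd p"
      using i by (simp_all add: last_conv_nth hd_conv_nth flip: i)
    then show ?thesis using c by (simp add: is_cycle_def)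
  qed
  obtain i where i: "i < ?n" "x = p ! i" using x by (auto simp: in_set_conv_nth)
  \<comment> \<open>\<open>t\<close> is the cyclic predecessor of position \<open>i\<close> and
    \<open>?s\<close> its successor; they differ because a cycle has at least three
    vertices.\<close>
  define t where "t = (if i = 0 then ?n - 1 else i - 1)"
  let ?s = "Suc i mod ?n"
  have "0 < ?n" using n by linarith
  then have s: "?s < ?n" "t < ?n" using i(1) by (auto simp: t_def intro: mod_less_divisor)
  have t: "Suc t mod ?n = i"
  proof (cases "i = 0")
    case True
    then have "Suc t = ?n" using n by (simp add: t_def)
    then show ?thesis using True by (metis mod_self)
  qed (use i(1) in \<open>simp add: t_def\<close>)
  have st: "?s \<noteq> t"
  proof (cases "Suc i < ?n")
    case True
    then show ?thesis using n by (auto simp: t_def)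
  next
    case False
    then have "Suc i = ?n" using i(1) by simp
    moreover from this have "?s = 0" by (metis mod_self)
    ultimately show ?thesis using n by (auto simp: t_def)
  qed
  have "{x, p ! ?s} \<in> edges G" using e[OF i(1)] i(2) by simp
  moreover have "{x, p ! t} \<in> edges G" using e[OF s(2)] t i(2) by (metis insert_commute)
  moreover have "p ! ?s \<noteq> p ! t" using d s st by (simp add: nth_eq_iff_index_eq)
  ultimately show thesis using that s by (meson nth_mem)
qed

text \<open>A cycle through \<open>x\<close> would give \<open>x\<close> two distinct neighbours in
  \<open>V\<close>, and a cycle avoiding \<open>x\<close> lies in \<open>V\<close> already.\<close>

lemma acyclic_insert_leaf:
  assumes acyc: "acyclic_graph (induced_subgraph G V)"
    and one: "\<And>u w. u \<in> V \<Longrightarrow> w \<in> V \<Longrightarrow> {x, u} \<in> edges G \<Longrightarrow> {x, w} \<in> edges G \<Longrightarrow> u = w"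
    and G: "simple_graph G"
  shows "acyclic_graph (induced_subgraph G (insert x V))"
  unfolding acyclic_graph_def
proof
  assume "\<exists>p. is_cycle (induced_subgraph G (insert x V)) p"
  then obtain p where p: "is_cycle (induced_subgraph G (insert x V)) p" by blast
  show False
  proof (cases "x \<in> set p")
    case True
    obtain u w where uw: "u \<noteq> w" "u \<in> set p" "w \<in> set p"
      "{x, u} \<in> edges (induced_subgraph G (insert x V))" "{x, w} \<in> edges (induced_subgraph G (insert x V))"
      using cycle_vertex_two_nbrs[OF p True] .
    then have "{x, u} \<in> edges G" "{x, w} \<in> edges G" "u \<in> insert x V" "w \<in> insert x V"
      by (auto simp: induced_subgraph_def)
    moreover from this have "u \<noteq> x" "w \<noteq> x" using simple_graph_edgeD(1)[OF G] by blast+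
    ultimately show False using one uw(1) by blast
  next
    case False
    have sub: "set p \<subseteq> V" using p False by (auto simp: is_cycle_def induced_subgraph_def)
    have ne: "p \<noteq> []" using p by (auto simp: is_cycle_def)
    have V: "p ! i \<in> V" if "i < length p" for i using sub that nth_mem by blast
    have "is_cycle (induced_subgraph G V) p"
      unfolding is_cycle_def
    proof (intro conjI allI impI)
      show "3 \<le> length p" "distinct p" using p by (auto simp: is_cycle_def)
      show "set p \<subseteq> verts (induced_subgraph G V)"
        using p sub by (auto simp: is_cycle_def induced_subgraph_def)
      show "{p ! i, p ! Suc i} \<in> edges (induced_subgraph G V)" if i: "Suc i < length p" for i
      proof -
        have "{p ! i, p ! Suc i} \<in> edges G" using p i by (simp add: is_cycle_def induced_subgraph_def)
        then show ?thesis using V[of i] V[OF i] i by (simp add: induced_subgraph_def)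
      qed
      have "{last p, hd p} \<in> edges G" using p by (simp add: is_cycle_def induced_subgraph_def)
      then show "{last p, hd p} \<in> edges (induced_subgraph G V)"
        using sub last_in_set[OF ne] hd_in_set[OF ne] by (auto simp: induced_subgraph_def)
    qed
    then show False using acyc by (auto simp: acyclic_graph_def)
  qed
qed

section \<open>Matchings as sequences of pairs\<close>

definition adj :: "'a sgraph \<Rightarrow> 'a \<Rightarrow> 'a \<Rightarrow> nat" where
  "adj G u v = (if {u, v} \<in> edges G then 1 else 0)"

lemma adj_commute: "adj G u v = adj G v u"
  by (simp add: adj_def insert_commute)

text \<open>Adjacencies are counted position by position, with repetitions and without assuming
  distinct vertices, so the value depends only on neighbourhoods and can be computed by a plain
  loop.\<close>

definition cross :: "'a sgraph \<Rightarrow> 'a \<Rightarrow> 'a \<Rightarrow> ('a \<times> 'a) list \<Rightarrow> nat" where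
  "cross G a b ps = (\<Sum>(p, q)\<leftarrow>ps. adj G a p + adj G a q + adj G b p + adj G b q)"

lemma cross_simps [simp]:
  "cross G a b [] = 0"
  "cross G a b ((p, q) # ps) = adj G a p + adj G a q + adj G b p + adj G b q + cross G a b ps"
  by (simp_all add: cross_def)

text \<open>The pairs are listed in reverse: the head of the list comes last in the sequence.\<close>

fun good :: "'a sgraph \<Rightarrow> nat \<Rightarrow> ('a \<times> 'a) list \<Rightarrow> bool" where
  "good G r [] \<longleftrightarrow> True"
| "good G r ((a, b) # ps) \<longleftrightarrow> {a, b} \<in> edges G \<and> cross G a b ps \<le> r \<and> good G r ps"

definition pair_edges :: "('a \<times> 'a) list \<Rightarrow> 'a set set" where
  "pair_edges ps = (\<lambda>(a, b). {a, b}) ` set ps"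

lemma pair_edges_simps [simp]: "pair_edges [] = {}" "pair_edges ((a, b) # ps) = insert {a, b} (pair_edges ps)"
  by (auto simp: pair_edges_def)

lemma good_edges: "good G r ps \<Longrightarrow> pair_edges ps \<subseteq> edges G"
  by (induction G r ps rule: good.induct) auto

lemma cross_ge:
  assumes "(p, q) \<in> set ps"
  shows "adj G a p + adj G a q + adj G b p + adj G b q \<le> cross G a b ps"
  using assms by (induction ps) auto

text \<open>A common vertex with an earlier pair already causes two edges to that pair.\<close>

lemma good_disjoint:
  assumes "good G r ps" "{a, b} \<in> edges G" "cross G a b ps \<le> 1"
  shows "a \<notin> \<Union>(pair_edges ps)" "b \<notin> \<Union>(pair_edges ps)"
proof -
  have *: "z \<noteq> p \<and> z \<noteq> q" if pq: "(p, q) \<in> set ps" and z: "z = a \<or> z = b" for p q z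
  proof -
    have "{p, q} \<in> edges G" using good_edges[OF assms(1)] pq by (auto simp: pair_edges_def)
    then show ?thesis
      using cross_ge[OF pq, of G a b] assms(2,3) z by (auto simp: adj_def insert_commute split: if_splits)
  qed
  show "a \<notin> \<Union>(pair_edges ps)" "b \<notin> \<Union>(pair_edges ps)"
    unfolding pair_edges_def using * by auto
qed

lemma good_matching:
  assumes "good G r ps" "r \<le> 1"
  shows "matching G (pair_edges ps) \<and> card (pair_edges ps) = length ps"
  using assms
proof (induction ps)
  case Nil
  then show ?case by (simp add: matching_def)
next
  case (Cons e ps)
  obtain a b where e: "e = (a, b)" by (cases e)
  have g: "good G r ps" "{a, b} \<in> edges G" "cross G a b ps \<le> 1" using Cons.prems e by auto
  note d = good_disjoint[OF g]
  have IH: "matching G (pair_edges ps)" "card (pair_edges ps) = length ps" using Cons.IH g(1) Cons.prems(2) by auto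
  have "{a, b} \<inter> f = {}" if "f \<in> pair_edges ps" for f using d that by auto
  then have "matching G (insert {a, b} (pair_edges ps))"
    using IH(1) g(2) unfolding matching_def by auto
  moreover have "{a, b} \<notin> pair_edges ps" using d by auto
  moreover have "finite (pair_edges ps)" by (simp add: pair_edges_def)
  ultimately show ?case using IH(2) e by simp
qed

lemma cross_eq_0:
  assumes "\<And>y. y \<in> \<Union>(pair_edges ps) \<Longrightarrow> {a, y} \<notin> edges G \<and> {b, y} \<notin> edges G"
  shows "cross G a b ps = 0"
  using assms by (induction ps) (auto simp: adj_def)

text \<open>No vertex occurs twice in a good list, so summing over positions and summing over
  vertices agree.\<close>

lemma sum_list_pairs:
  assumes "simple_graph G" "good G r ps" "r \<le> 1"
  shows "(\<Sum>(p, q)\<leftarrow>ps. f p + f q) = (\<Sum>y\<in>\<Union>(pair_edges ps). f y :: nat)"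
  using assms(2)
proof (induction ps)
  case (Cons e ps)
  obtain a b where e: "e = (a, b)" by (cases e)
  have g: "good G r ps" "{a, b} \<in> edges G" "cross G a b ps \<le> 1" using Cons.prems e assms(3) by auto
  have ab: "a \<noteq> b" using simple_graph_edgeD[OF assms(1) g(2)] by simp
  have "finite (\<Union>(pair_edges ps))" by (auto simp: pair_edges_def)
  then show ?case using Cons.IH[OF g(1)] good_disjoint[OF g] ab e by (simp add: add.assoc)
qed simp

lemma cross_conv_sum:
  assumes "simple_graph G" "good G r ps" "r \<le> 1"
  shows "cross G a b ps = (\<Sum>y\<in>\<Union>(pair_edges ps). adj G a y + adj G b y)"
  unfolding sum_list_pairs[OF assms, symmetric] cross_def
  by (intro arg_cong[where f = sum_list] map_cong) auto

lemma good_induced_edges: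
  assumes "simple_graph G" "good G 0 ps"
  shows "edges (induced_subgraph G (\<Union>(pair_edges ps))) = pair_edges ps"
  using assms(2)
proof (induction ps)
  case Nil
  have "{} \<notin> edges G" using simple_graph_edgeE[OF assms(1)] by blast
  then show ?case by (auto simp: induced_subgraph_def)
next
  case (Cons e ps)
  obtain a b where e: "e = (a, b)" by (cases e)
  have g: "good G 0 ps" "{a, b} \<in> edges G" "cross G a b ps = 0" using Cons.prems e by auto
  have no: "{a, y} \<notin> edges G \<and> {b, y} \<notin> edges G" if y: "y \<in> \<Union>(pair_edges ps)" for y
  proof -
    obtain p q where pq: "(p, q) \<in> set ps" "y = p \<or> y = q" using y by (auto simp: pair_edges_def)
    have "adj G a p + adj G a q + adj G b p + adj G b q = 0"
      using cross_ge[OF pq(1), of G a b] g(3) by linarith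
    then have "adj G a y = 0" "adj G b y = 0" using pq(2) by auto
    then show ?thesis by (simp add: adj_def split: if_splits)
  qed
  have IH: "{e \<in> edges G. e \<subseteq> \<Union>(pair_edges ps)} = pair_edges ps"
    using Cons.IH[OF g(1)] unfolding induced_subgraph_def sgraph.simps .
  have "{e \<in> edges G. e \<subseteq> {a, b} \<union> \<Union>(pair_edges ps)} \<subseteq> insert {a, b} (pair_edges ps)"
  proof
    fix f assume f: "f \<in> {e \<in> edges G. e \<subseteq> {a, b} \<union> \<Union>(pair_edges ps)}"
    then have "f \<in> edges G" by simp
    from simple_graph_edgeE[OF assms(1) this] obtain x y where xy: "x \<noteq> y" "f = {x, y}" by metis
    have xV: "x \<in> {a, b} \<union> \<Union>(pair_edges ps)" "y \<in> {a, b} \<union> \<Union>(pair_edges ps)"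
      using f xy(2) by blast+
    consider "x \<in> {a, b}" "y \<in> {a, b}" | "x \<in> {a, b}" "y \<in> \<Union>(pair_edges ps)"
      | "y \<in> {a, b}" "x \<in> \<Union>(pair_edges ps)" | "x \<in> \<Union>(pair_edges ps)" "y \<in> \<Union>(pair_edges ps)"
      using xV by (elim UnE)
    then show "f \<in> insert {a, b} (pair_edges ps)"
    proof cases
      case 1
      then have "{x, y} = {a, b}" using xy(1) by blast
      then show ?thesis using xy(2) by blast
    next
      case 2
      then show ?thesis using no[OF 2(2)] f xy(2) by blast
    next
      case 3
      moreover have "{y, x} \<in> edges G" using f xy(2) by (simp add: insert_commute)
      ultimately show ?thesis using no[OF 3(2)] by blast
    next
      case 4
      then have "f \<in> {e \<in> edges G. e \<subseteq> \<Union>(pair_edges ps)}" using f xy(2) by blast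
      then show ?thesis unfolding IH by blast
    qed
  qed
  moreover have "insert {a, b} (pair_edges ps) \<subseteq> {e \<in> edges G. e \<subseteq> {a, b} \<union> \<Union>(pair_edges ps)}"
    using good_edges[OF g(1)] g(2) by auto
  ultimately have "{e \<in> edges G. e \<subseteq> {a, b} \<union> \<Union>(pair_edges ps)} = insert {a, b} (pair_edges ps)" by blast
  moreover have "\<Union>(pair_edges (e # ps)) = {a, b} \<union> \<Union>(pair_edges ps)" by (simp add: e)
  ultimately show ?case unfolding induced_subgraph_def sgraph.simps by (simp only: e pair_edges_simps)
qed

text \<open>At most one edge joins the new pair to the earlier vertices, so one end of the pair has
  no neighbour among them. Insert the other end first, then this one: each is attached by at most
  one edge, the second only to its partner.\<close>

lemma good_acyclic:
  assumes "simple_graph G" "good G 1 ps"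
  shows "acyclic_graph (induced_subgraph G (\<Union>(pair_edges ps)))"
  using assms(2)
proof (induction ps)
  case Nil
  then show ?case by (auto simp: acyclic_graph_def is_cycle_def induced_subgraph_def)
next
  case (Cons e ps)
  let ?V = "\<Union>(pair_edges ps)"
  obtain a b where e: "e = (a, b)" by (cases e)
  have g: "good G 1 ps" "{a, b} \<in> edges G" "cross G a b ps \<le> 1" using Cons.prems e by auto
  have ab: "a \<noteq> b" using simple_graph_edgeD[OF assms(1) g(2)] by simp
  have one: "x = x' \<and> y = y'"
    if xy: "x \<in> {a, b}" "y \<in> ?V" "{x, y} \<in> edges G" and xy': "x' \<in> {a, b}" "y' \<in> ?V" "{x', y'} \<in> edges G"
    for x y x' y'
  proof (rule ccontr)
    assume ne: "\<not> ?thesis"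
    have "finite ?V" by (auto simp: pair_edges_def)
    \<comment> \<open>Two different connecting edges contribute at least 2 on
      \<open>{y, y'}\<close>, also when \<open>y = y'\<close> and they come from both ends of the
      pair.\<close>
    then have "(\<Sum>z\<in>{y, y'}. adj G a z + adj G b z) \<le> (\<Sum>z\<in>?V. adj G a z + adj G b z)"
      using xy(2) xy'(2) by (intro sum_mono2) auto
    then have "(\<Sum>z\<in>{y, y'}. adj G a z + adj G b z) \<le> 1"
      using cross_conv_sum[OF assms(1) g(1)] g(3) by simp
    then show False
      using xy xy' ne ab by (cases "y = y'") (auto simp: adj_def)
  qed
  note d = good_disjoint[OF g]
  have acyc: "acyclic_graph (induced_subgraph G ?V)" by (rule Cons.IH[OF g(1)])
  have two: "acyclic_graph (induced_subgraph G (insert y (insert x ?V)))"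
    if xy: "{x, y} = {a, b}" "\<forall>z\<in>?V. {y, z} \<notin> edges G" for x y
  proof (rule acyclic_insert_leaf[OF _ _ assms(1)])
    show "acyclic_graph (induced_subgraph G (insert x ?V))"
      using xy one by (intro acyclic_insert_leaf[OF acyc _ assms(1)]) blast
    show "u = w" if "u \<in> insert x ?V" "w \<in> insert x ?V" "{y, u} \<in> edges G" "{y, w} \<in> edges G" for u w
      using that xy(2) by blast
  qed
  have "(\<forall>z\<in>?V. {b, z} \<notin> edges G) \<or> (\<forall>z\<in>?V. {a, z} \<notin> edges G)"
    using one ab by blast
  then show ?case
    using two[of a b] two[of b a] e by (auto simp: insert_commute)
qed

section \<open>Matchings as good lists, by averaging over the matching edges\<close>

lemma matching_disjoint: "matching G M \<Longrightarrow> e \<in> M \<Longrightarrow> f \<in> M \<Longrightarrow> e \<noteq> f \<Longrightarrow> e \<inter> f = {}"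
  by (simp add: matching_def)

lemma matching_finite:
  assumes "simple_graph G" "matching G M"
  shows "finite M" "finite (\<Union>M)" "\<Union>M \<subseteq> verts G"
proof -
  show *: "\<Union>M \<subseteq> verts G"
    using assms simple_graph_edge_subset[OF assms(1)] by (auto simp: matching_def)
  show "finite M" using assms simple_graph_finite(2)[OF assms(1)] finite_subset by (auto simp: matching_def)
  show "finite (\<Union>M)" using * simple_graph_finite(1)[OF assms(1)] finite_subset by auto
qed

lemma matching_sum:
  assumes "simple_graph G" "matching G M"
  shows "(\<Sum>x\<in>\<Union>M. f x) = (\<Sum>e\<in>M. \<Sum>x\<in>e. f x :: nat)"
proof -
  have "\<forall>e\<in>M. finite e" using matching_finite(2)[OF assms] by (meson Union_upper finite_subset)
  moreover have "\<forall>A\<in>M. \<forall>B\<in>M. A \<noteq> B \<longrightarrow> A \<inter> B = {}" using assms(2) by (auto simp: matching_def)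
  ultimately show ?thesis using sum.Union_disjoint[of M f] by simp
qed

lemma matching_card_Union:
  assumes "simple_graph G" "matching G M"
  shows "card (\<Union>M) = 2 * card M"
proof -
  have "card e = 2" if e: "e \<in> M" for e
  proof -
    have "e \<in> edges G" using assms(2) e unfolding matching_def by blast
    from simple_graph_edgeE[OF assms(1) this] show ?thesis by (metis card_2_iff)
  qed
  then have "(\<Sum>e\<in>M. card e) = 2 * card M" by simp
  then show ?thesis using matching_sum[OF assms, of "\<lambda>_. 1"] by simp
qed

lemma card_nbrs_induced:
  assumes "a \<in> W" "finite W"
  shows "card (nbrs (induced_subgraph G W) a) = (\<Sum>y\<in>W. adj G a y)"
proof -
  have "nbrs (induced_subgraph G W) a = {y \<in> W. {a, y} \<in> edges G}"
    using assms(1) by (auto simp: nbrs_def induced_subgraph_def)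
  then show ?thesis using assms(2) by (simp add: adj_def sum.If_cases Int_def)
qed

text \<open>The degrees of the covered vertices, grouped by matching edge, add up to twice the
  number of induced edges; an edge with the least degree sum is at most average.\<close>

lemma matching_low_edge:
  assumes "simple_graph G" "matching G M" "M \<noteq> {}"
  obtains e where "e \<in> M"
    "card M * (\<Sum>x\<in>e. \<Sum>y\<in>\<Union>M. adj G x y) \<le> 2 * card (edges (induced_subgraph G (\<Union>M)))"
proof -
  let ?W = "\<Union>M" and ?D = "\<lambda>e. \<Sum>x\<in>e. \<Sum>y\<in>\<Union>M. adj G x y"
  note fin = matching_finite[OF assms(1,2)]
  let ?G = "induced_subgraph G ?W"
  have V: "verts ?G = ?W" using fin(3) by (auto simp: induced_subgraph_def)
  have "(\<Sum>e\<in>M. ?D e) = (\<Sum>x\<in>?W. \<Sum>y\<in>?W. adj G x y)"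
    using matching_sum[OF assms(1,2)] by simp
  also have "\<dots> = (\<Sum>x\<in>verts ?G. card (nbrs ?G x))"
    unfolding V using card_nbrs_induced[OF _ fin(2)] by simp
  also have "\<dots> = 2 * card (edges ?G)" by (rule handshake[OF simple_graph_induced[OF assms(1)]])
  finally have sum: "(\<Sum>e\<in>M. ?D e) = 2 * card (edges ?G)" .
  obtain e where e: "e \<in> M" "\<And>f. f \<in> M \<Longrightarrow> ?D e \<le> ?D f"
    using ex_is_arg_min_if_finite[OF fin(1) assms(3), of ?D] unfolding is_arg_min_linorder by blast
  from e(2) have "card M * ?D e \<le> (\<Sum>e\<in>M. ?D e)"
    using sum_bounded_below[of M "?D e" ?D] by (metis of_nat_id)
  then have "card M * ?D e \<le> 2 * card (edges ?G)" unfolding sum .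
  then show thesis by (rule that[OF e(1)])
qed

text \<open>The summand 2 is the edge \<open>{a, b}\<close> itself, seen from both ends.\<close>

lemma matching_edge_degree:
  assumes "simple_graph G" "matching G M" "{a, b} \<in> M"
  shows "(\<Sum>x\<in>{a, b}. \<Sum>y\<in>\<Union>M. adj G x y) = 2 + (\<Sum>y\<in>\<Union>(M - {{a, b}}). adj G a y + adj G b y)"
proof -
  note fin = matching_finite[OF assms(1,2)]
  let ?W = "\<Union>(M - {{a, b}})"
  have ab: "{a, b} \<in> edges G" using assms(2,3) unfolding matching_def by blast
  then have ne: "a \<noteq> b" by (rule simple_graph_edgeD(1)[OF assms(1)])
  have "\<Union>M = {a, b} \<union> ?W" using insert_Diff[OF assms(3)] Union_insert by metis
  then have W: "\<Union>M = insert a (insert b ?W)" by simp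
  have "f \<inter> {a, b} = {}" if "f \<in> M - {{a, b}}" for f
    using matching_disjoint[OF assms(2) _ assms(3)] that by simp
  then have notin: "a \<notin> ?W" "b \<notin> ?W" by blast+
  have finW: "finite ?W" using fin(2) by (rule rev_finite_subset) (rule Union_mono[OF Diff_subset])
  have sum: "(\<Sum>y\<in>\<Union>M. f y) = f a + (f b + (\<Sum>y\<in>?W. f y))" for f :: "'a \<Rightarrow> nat"
    unfolding W using notin ne finW by (simp del: Union_iff)
  have "adj G a a = 0" "adj G b b = 0" "adj G a b = 1" "adj G b a = 1"
    using ab simple_graph_edgeD(1)[OF assms(1), of a a] simple_graph_edgeD(1)[OF assms(1), of b b]
    by (auto simp: adj_def insert_commute)
  then show ?thesis using ne by (simp add: sum sum.distrib)
qed

lemma matching_subset: "matching G M \<Longrightarrow> N \<subseteq> M \<Longrightarrow> matching G N"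
  unfolding matching_def by blast

text \<open>A forest on \<open>2 * card M\<close> vertices has fewer than \<open>2 * card M\<close>
  edges, so some matching edge has degree sum at most 3 and thus at most one edge to the rest. It
  becomes the last pair of the sequence; the others are ordered by induction.\<close>

lemma acyclic_matching_good:
  assumes G: "simple_graph G" and "acyclic_matching G M"
  shows "\<exists>ps. good G 1 ps \<and> pair_edges ps = M \<and> length ps = card M"
  using assms(2)
proof (induction "card M" arbitrary: M)
  case 0
  then have "M = {}" using matching_finite(1)[OF G] by (auto simp: acyclic_matching_def)
  then show ?case by (auto intro!: exI[of _ "[]"])
next
  case (Suc m)
  have M: "matching G M" and ac: "acyclic_graph (induced_subgraph G (\<Union>M))"
    using Suc.prems by (auto simp: acyclic_matching_def)
  note fin = matching_finite[OF G M]
  have "M \<noteq> {}" using Suc.hyps(2) by auto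
  then obtain e where e: "e \<in> M"
    "card M * (\<Sum>x\<in>e. \<Sum>y\<in>\<Union>M. adj G x y) \<le> 2 * card (edges (induced_subgraph G (\<Union>M)))"
    using matching_low_edge[OF G M] by blast
  obtain a b where ab: "e = {a, b}" using e(1) M simple_graph_edgeE[OF G] by (metis matching_def subsetD)
  have V: "verts (induced_subgraph G (\<Union>M)) = \<Union>M" using fin(3) by (auto simp: induced_subgraph_def)
  have "\<Union>M \<noteq> {}" using e(1) unfolding ab by blast
  then have "card (edges (induced_subgraph G (\<Union>M))) < 2 * card M"
    using acyclic_card_edges[OF simple_graph_induced[OF G] ac] V matching_card_Union[OF G M] by simp
  then have "card M * (\<Sum>x\<in>e. \<Sum>y\<in>\<Union>M. adj G x y) < card M * 4" using e(2) by linarith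
  then have "(\<Sum>x\<in>e. \<Sum>y\<in>\<Union>M. adj G x y) < 4" by simp
  then have low: "(\<Sum>y\<in>\<Union>(M - {e}). adj G a y + adj G b y) \<le> 1"
    using matching_edge_degree[OF G M] e(1) ab by simp
  have "acyclic_matching G (M - {e})"
    using matching_subset[OF M] acyclic_induced_mono[OF ac, of "\<Union>(M - {e})"]
    by (auto simp: acyclic_matching_def)
  moreover have c: "card (M - {e}) = m" using Suc.hyps(2) e(1) fin(1) by simp
  ultimately obtain ps where ps: "good G 1 ps" "pair_edges ps = M - {e}" "length ps = m"
    using Suc.hyps(1)[of "M - {e}"] by auto
  have "cross G a b ps \<le> 1" using cross_conv_sum[OF G ps(1)] ps(2) low by simp
  moreover have "{a, b} \<in> edges G" using e(1) ab M by (auto simp: matching_def)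
  ultimately have "good G 1 ((a, b) # ps)" using ps(1) by simp
  moreover have "pair_edges ((a, b) # ps) = M" using ps(2) ab e(1) by auto
  ultimately show ?case using ps(3) Suc.hyps(2) by (metis length_Cons)
qed

lemma separated_matching_good:
  assumes G: "simple_graph G" and "matching G M"
    and "\<And>e f x y. e \<in> M \<Longrightarrow> f \<in> M \<Longrightarrow> e \<noteq> f \<Longrightarrow> x \<in> e \<Longrightarrow> y \<in> f \<Longrightarrow> {x, y} \<notin> edges G"
  shows "\<exists>ps. good G 0 ps \<and> pair_edges ps = M \<and> length ps = card M"
  using matching_finite(1)[OF assms(1,2)] assms(2,3)
proof (induction M rule: finite_induct)
  case empty
  show ?case by (auto intro!: exI[of _ "[]"])
next
  case (insert e M)
  have "matching G M" using matching_subset[OF insert.prems(1)] by blast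
  then obtain ps where ps: "good G 0 ps" "pair_edges ps = M" "length ps = card M"
    using insert.IH insert.prems(2) by (metis insertCI)
  have eG: "e \<in> edges G" using insert.prems(1) by (simp add: matching_def)
  obtain a b where ab: "e = {a, b}" using simple_graph_edgeE[OF G eG] .
  have "cross G a b ps = 0"
    using insert.prems(2)[of e] insert.hyps(2) ab ps(2) by (intro cross_eq_0) auto
  then have "good G 0 ((a, b) # ps)" using ps(1) eG ab by simp
  moreover have "pair_edges ((a, b) # ps) = insert e M" using ps(2) ab by simp
  ultimately show ?case using ps(3) insert.hyps by (metis card_insert_disjoint length_Cons)
qed

text \<open>The cardinality condition forces the induced edges to be exactly \<open>M\<close>. An
  edge between two different matching edges would then lie in \<open>M\<close> and meet both of
  them.\<close>

lemma induced_matching_good: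
  assumes G: "simple_graph G" and "induced_matching G M"
  shows "\<exists>ps. good G 0 ps \<and> length ps = card M"
proof -
  have M: "matching G M" and c: "card (edges (induced_subgraph G (\<Union>M))) = card M"
    using assms(2) by (auto simp: induced_matching_def)
  have "M \<subseteq> edges (induced_subgraph G (\<Union>M))"
    using M by (auto simp: matching_def induced_subgraph_def)
  then have eq: "edges (induced_subgraph G (\<Union>M)) = M"
    using c simple_graph_finite(2)[OF simple_graph_induced[OF G]] by (metis card_subset_eq)
  have "{x, y} \<notin> edges G" if *: "e \<in> M" "f \<in> M" "e \<noteq> f" "x \<in> e" "y \<in> f" for e f x y
  proof
    assume "{x, y} \<in> edges G"
    moreover have "{x, y} \<subseteq> \<Union>M" using * by blast
    ultimately have "{x, y} \<in> edges (induced_subgraph G (\<Union>M))" by (simp add: induced_subgraph_def)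
    then have xy: "{x, y} \<in> M" unfolding eq .
    have "{x, y} = e" "{x, y} = f"
      using matching_disjoint[OF M xy *(1)] matching_disjoint[OF M xy *(2)] *(4,5) by blast+
    then show False using *(3) by simp
  qed
  then show ?thesis using separated_matching_good[OF G M] by metis
qed

theorem acyclic_matching_iff_good:
  assumes "simple_graph G"
  shows "(\<exists>M. acyclic_matching G M \<and> card M = k) \<longleftrightarrow> (\<exists>ps. good G 1 ps \<and> length ps = k)"
  using acyclic_matching_good[OF assms] good_matching[of G 1] good_acyclic[OF assms]
  unfolding acyclic_matching_def by (metis order_refl)

theorem induced_matching_iff_good:
  assumes "simple_graph G"
  shows "(\<exists>M. induced_matching G M \<and> card M = k) \<longleftrightarrow> (\<exists>ps. good G 0 ps \<and> length ps = k)"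
  using induced_matching_good[OF assms] good_matching[of G 0] good_induced_edges[OF assms]
  unfolding induced_matching_def by (metis zero_le_one)

text \<open>Repeatedly choose an edge of the matching with few edges to the rest, and discard the
  matching edges adjacent to it.\<close>

lemma sparse_matching_good:
  assumes G: "simple_graph G" and d: "d > 0"
    and sparse: "\<And>S. S \<subseteq> verts G \<Longrightarrow> S \<noteq> {} \<Longrightarrow> card (edges (induced_subgraph G S)) < d * card S"
    and "matching G M" "4 * d * k \<le> card M"
  shows "\<exists>ps. good G 0 ps \<and> length ps = k \<and> pair_edges ps \<subseteq> M"
  using assms(4,5)
proof (induction k arbitrary: M)
  case 0
  show ?case by (auto intro!: exI[of _ "[]"])
next
  case (Suc k)
  note M = Suc.prems(1)
  note fin = matching_finite[OF G M]
  have "0 < 4 * d * Suc k" using d by simp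
  then have "card M > 0" using Suc.prems(2) by linarith
  then have ne: "M \<noteq> {}" by auto
  then obtain e where e: "e \<in> M"
    "card M * (\<Sum>x\<in>e. \<Sum>y\<in>\<Union>M. adj G x y) \<le> 2 * card (edges (induced_subgraph G (\<Union>M)))"
    using matching_low_edge[OF G M] by blast
  have eG: "e \<in> edges G" using e(1) M by (auto simp: matching_def)
  obtain a b where ab: "e = {a, b}" using simple_graph_edgeE[OF G eG] .
  have "\<Union>M \<noteq> {}" using e(1) unfolding ab by blast
  then have "card (edges (induced_subgraph G (\<Union>M))) < d * (2 * card M)"
    using sparse[OF fin(3)] matching_card_Union[OF G M] by simp
  \<comment> \<open>The degree sum over the covered vertices is twice the number of induced edges,
    which are fewer than \<open>d * (2 * card M)\<close>. An average matching edge thus gets less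
    than \<open>4 * d\<close>.\<close>
  moreover have "2 * (d * (2 * card M)) = card M * (4 * d)" by simp
  ultimately have "card M * (\<Sum>x\<in>e. \<Sum>y\<in>\<Union>M. adj G x y) < card M * (4 * d)" using e(2) by linarith
  then have "(\<Sum>x\<in>e. \<Sum>y\<in>\<Union>M. adj G x y) < 4 * d" by simp
  moreover define W where "W = \<Union>(M - {e})"
  ultimately have low: "2 + (\<Sum>y\<in>W. adj G a y + adj G b y) < 4 * d"
    using matching_edge_degree[OF G M] e(1) ab by simp
  have finW: "finite W" unfolding W_def using fin(2) by (rule rev_finite_subset) (rule Union_mono[OF Diff_subset])
  define Y where "Y = {y \<in> W. {a, y} \<in> edges G \<or> {b, y} \<in> edges G}"
  have "card Y = (\<Sum>y\<in>Y. 1)" by simp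
  also have "\<dots> \<le> (\<Sum>y\<in>Y. adj G a y + adj G b y)" by (intro sum_mono) (auto simp: Y_def adj_def)
  also have "\<dots> \<le> (\<Sum>y\<in>W. adj G a y + adj G b y)" using finW by (intro sum_mono2) (auto simp: Y_def)
  finally have cY: "card Y + 2 < 4 * d" using low by simp
  \<comment> \<open>The matching edges that touch a neighbour of \<open>a\<close> or
    \<open>b\<close>. Each element of \<open>Y\<close> lies in only one matching edge, so there are
    at most \<open>card Y\<close> of them.\<close>
  define C where "C = {f \<in> M - {e}. f \<inter> Y \<noteq> {}}"
  have "card C \<le> card Y"
  proof (rule surj_card_le[where f = "\<lambda>y. THE f. f \<in> M \<and> y \<in> f"])
    show "finite Y" using finW by (simp add: Y_def)
    show "C \<subseteq> (\<lambda>y. THE f. f \<in> M \<and> y \<in> f) ` Y"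
    proof
      fix f assume "f \<in> C"
      then obtain y where y: "f \<in> M" "y \<in> f" "y \<in> Y" unfolding C_def by blast
      have "g = f" if "g \<in> M" "y \<in> g" for g
        using matching_disjoint[OF M that(1) y(1)] that(2) y(2) by blast
      then have "(THE f. f \<in> M \<and> y \<in> f) = f"
        using y(1,2) by (intro the_equality) blast+
      then show "f \<in> (\<lambda>y. THE f. f \<in> M \<and> y \<in> f) ` Y" using y(3) by blast
    qed
  qed
  define N where "N = M - {e} - C"
  have "C \<subseteq> M - {e}" unfolding C_def by (rule Collect_restrict)
  then have "M - {e} = N \<union> C" unfolding N_def by blast
  then have "card (M - {e}) \<le> card N + card C" using card_Un_le[of N C] by simp
  moreover have "card (M - {e}) = card M - 1" using e(1) fin(1) by simp
  \<comment> \<open>With \<open>e\<close> included, fewer than \<open>4 * d\<close> edges are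
    discarded per chosen edge, hence the size \<open>4 * d * k\<close> required at the
    start.\<close>
  ultimately have "4 * d * k \<le> card N"
    using \<open>card C \<le> card Y\<close> cY Suc.prems(2) unfolding mult_Suc_right by linarith
  moreover have "N \<subseteq> M" unfolding N_def by blast
  then have "matching G N" by (rule matching_subset[OF M])
  ultimately obtain ps where ps: "good G 0 ps" "length ps = k" "pair_edges ps \<subseteq> N"
    using Suc.IH by blast
  have "cross G a b ps = 0"
  proof (rule cross_eq_0)
    fix y assume "y \<in> \<Union>(pair_edges ps)"
    then obtain f where f: "f \<in> M - {e}" "f \<notin> C" "y \<in> f" using ps(3) unfolding N_def by blast
    then have "y \<notin> Y" "y \<in> W" unfolding C_def W_def by blast+
    then show "{a, y} \<notin> edges G \<and> {b, y} \<notin> edges G" by (simp add: Y_def)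
  qed
  then have "good G 0 ((a, b) # ps)" using ps(1) eG ab by simp
  moreover have "pair_edges ((a, b) # ps) \<subseteq> M" using ps(3) e(1) ab unfolding N_def by auto
  ultimately show ?case using ps(2) by (metis length_Cons)
qed

text \<open>The vertices of a maximum matching form a cover of size at most \<open>2 * m\<close>. A
  vertex outside it has its neighbourhood inside the cover, so such vertices show at most
  \<open>2 ^ (2 * m)\<close> neighbourhoods.\<close>

lemma card_distinct_nbrs_le:
  assumes G: "simple_graph G" and small: "\<And>M. matching G M \<Longrightarrow> card M \<le> m"
    and R: "R \<subseteq> verts G" "inj_on (nbrs G) R"
  shows "card R \<le> 2 * m + 2 ^ (2 * m)"
proof -
  have "matching G {}" by (simp add: matching_def)
  moreover have "\<forall>M. matching G M \<longrightarrow> card M < Suc m" using small by (simp add: less_Suc_eq_le)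
  ultimately obtain M where M: "matching G M" and max: "\<And>N. matching G N \<Longrightarrow> card N \<le> card M"
    using ex_has_greatest_nat[of "matching G" "{}" card "Suc m"] by (metis less_imp_le)
  let ?S = "\<Union>M"
  note fin = matching_finite[OF G M]
  have cS: "card ?S \<le> 2 * m" using matching_card_Union[OF G M] small[OF M] by simp
  have sub: "nbrs G v \<subseteq> ?S" if v: "v \<notin> ?S" for v
  proof
    fix w assume "w \<in> nbrs G v"
    then have vw: "{v, w} \<in> edges G" by (simp add: nbrs_def)
    show "w \<in> ?S"
    proof (rule ccontr)
      assume w: "w \<notin> ?S"
      then have "{v, w} \<inter> f = {}" if "f \<in> M" for f using v that by auto
      then have "matching G (insert {v, w} M)" using M vw unfolding matching_def by auto
      moreover have "{v, w} \<notin> M" using v by auto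
      ultimately show False using max[of "insert {v, w} M"] fin(1) by simp
    qed
  qed
  have finR: "finite R" using R(1) simple_graph_finite(1)[OF G] finite_subset by blast
  have "card (R - ?S) \<le> card (Pow ?S)"
    using R(2) sub fin(2) by (intro card_inj_on_le[where f = "nbrs G"]) (auto intro: inj_on_subset)
  also have "\<dots> \<le> 2 ^ (2 * m)" using cS fin(2) by (simp add: card_Pow)
  finally have "card (R - ?S) \<le> 2 ^ (2 * m)" .
  moreover have "card (R \<inter> ?S) \<le> 2 * m" using card_mono[OF fin(2), of "R \<inter> ?S"] cS by simp
  moreover have "card R \<le> card (R \<inter> ?S) + card (R - ?S)"
    using card_Un_le[of "R \<inter> ?S" "R - ?S"] by (simp add: Int_Diff_Un)
  ultimately show ?thesis by simp
qed

section \<open>Structured programs for the random access machine\<close>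

datatype com = Block "instr list" | Seq com com (infixr \<open>;;\<close> 60) | While nat com

fun no_jump :: "instr \<Rightarrow> bool" where
  "no_jump (Jump a) = False"
| "no_jump (JumpZero i a) = False"
| "no_jump _ = True"

fun jump_free :: "com \<Rightarrow> bool" where
  "jump_free (Block is) = list_all no_jump is"
| "jump_free (c ;; d) = (jump_free c \<and> jump_free d)"
| "jump_free (While i c) = jump_free c"

fun csize :: "com \<Rightarrow> nat" where
  "csize (Block is) = length is"
| "csize (c ;; d) = csize c + csize d"
| "csize (While i c) = csize c + 2"

text \<open>Jump targets are absolute, so the address \<open>a\<close> of the first instruction is
  passed down; a loop is left to the address just behind its closing jump.\<close>

fun compile :: "nat \<Rightarrow> com \<Rightarrow> instr list" where
  "compile a (Block is) = is"
| "compile a (c ;; d) = compile a c @ compile (a + csize c) d"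
| "compile a (While i c) = JumpZero i (a + csize c + 2) # compile (Suc a) c @ [Jump a]"

lemma length_compile [simp]: "length (compile a c) = csize c"
  by (induction c arbitrary: a) auto

definition effect :: "nat list \<Rightarrow> instr \<Rightarrow> (nat \<Rightarrow> nat) \<Rightarrow> nat \<Rightarrow> nat" where
  "effect x i R = snd (exec x i (0, R))"

lemma effect_simps [simp]:
  "effect x (Const i c) R = R(i := c)"
  "effect x (Add i j l) R = R(i := R j + R l)"
  "effect x (Sub i j l) R = R(i := R j - R l)"
  "effect x (Half i j) R = R(i := R j div 2)"
  "effect x (Load i j) R = R(i := R (R j))"
  "effect x (Store i j) R = R(R i := R j)"
  "effect x (Read i j) R = R(i := (if R j < length x then x ! R j else 0))"
  by (simp_all add: effect_def)

lemma exec_no_jump: "no_jump i \<Longrightarrow> exec x i (pc, R) = (Suc pc, effect x i R)"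
  by (cases i) (auto simp: effect_def)

text \<open>The step count is that of the compiled code: 2 per iteration for test and jump back, 1
  for the final test.\<close>

inductive run :: "nat list \<Rightarrow> com \<Rightarrow> (nat \<Rightarrow> nat) \<Rightarrow> nat \<Rightarrow> (nat \<Rightarrow> nat) \<Rightarrow> bool" for x where
  run_block: "run x (Block is) R (length is) (fold (effect x) is R)"
| run_seq: "run x c R t R' \<Longrightarrow> run x d R' t' R'' \<Longrightarrow> run x (c ;; d) R (t + t') R''"
| run_while_end: "R i = 0 \<Longrightarrow> run x (While i c) R 1 R"
| run_while_step: "R i \<noteq> 0 \<Longrightarrow> run x c R t R' \<Longrightarrow> run x (While i c) R' t' R'' \<Longrightarrow>
    run x (While i c) R (t + t' + 2) R''"

lemma step_at: "step (pre @ i # post) x (length pre, R) = exec x i (length pre, R)"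
  by (simp add: step_def)

lemma run_block_steps:
  assumes "list_all no_jump is"
  shows "(step (pre @ is @ post) x ^^ length is) (length pre, R) =
    (length pre + length is, fold (effect x) is R)"
  using assms
proof (induction "is" arbitrary: pre R)
  case (Cons i "is")
  have "step (pre @ (i # is) @ post) x (length pre, R) = (Suc (length pre), effect x i R)"
    using Cons.prems step_at[of pre i "is @ post"] exec_no_jump by simp
  then show ?case
    using Cons.IH[of "pre @ [i]" "effect x i R"] Cons.prems
    by (simp add: funpow_swap1 del: funpow.simps add: funpow_Suc_right)
qed simp

text \<open>Arbitrary surrounding code \<open>pre\<close> and \<open>post\<close> lets the induction
  hypotheses apply to subprograms in place.\<close>

lemma run_compile:
  assumes "run x c R t R'" "jump_free c"
  shows "(step (pre @ compile (length pre) c @ post) x ^^ t) (length pre, R) =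
    (length pre + csize c, R')"
  using assms
proof (induction arbitrary: pre post rule: run.induct)
  case (run_block "is" R)
  then show ?case using run_block_steps by simp
next
  case (run_seq c R t R' d t' R'')
  have 1: "(step (pre @ compile (length pre) (c ;; d) @ post) x ^^ t) (length pre, R) =
      (length pre + csize c, R')"
    using run_seq.IH(1)[of pre "compile (length pre + csize c) d @ post"] run_seq.prems by simp
  have 2: "(step (pre @ compile (length pre) (c ;; d) @ post) x ^^ t') (length pre + csize c, R') =
      (length pre + csize c + csize d, R'')"
    using run_seq.IH(2)[of "pre @ compile (length pre) c" post] run_seq.prems by simp
  show ?case
    using 1 2 by (simp add: add.commute[of t t'] funpow_add add.assoc)
next
  case (run_while_end R i c)
  then show ?case using step_at by simp
next
  case (run_while_step R i c t R' t' R'')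
  let ?P = "pre @ compile (length pre) (While i c) @ post"
  have 1: "step ?P x (length pre, R) = (Suc (length pre), R)"
    using run_while_step.hyps by (simp add: step_at)
  have 2: "(step ?P x ^^ t) (Suc (length pre), R) = (Suc (length pre + csize c), R')"
    using run_while_step.IH(1)[of "pre @ [JumpZero i (length pre + csize c + 2)]" "Jump (length pre) # post"]
      run_while_step.prems by simp
  have 3: "step ?P x (Suc (length pre + csize c), R') = (length pre, R')"
    using step_at[of "pre @ JumpZero i (length pre + csize c + 2) # compile (Suc (length pre)) c"
        "Jump (length pre)" post] by simp
  have 4: "(step ?P x ^^ t') (length pre, R') = (length pre + csize (While i c), R'')"
    using run_while_step.IH(2) run_while_step.prems by simp
  have "(step ?P x ^^ (t' + (1 + (t + 1)))) (length pre, R) = (length pre + csize (While i c), R'')"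
    unfolding funpow_add o_def using 1 2 3 4 by simp
  then show ?case by (simp add: algebra_simps)
qed

section \<open>Correctness rules with time bounds\<close>

definition wp :: "nat list \<Rightarrow> com \<Rightarrow> nat \<Rightarrow> ((nat \<Rightarrow> nat) \<Rightarrow> bool) \<Rightarrow> (nat \<Rightarrow> nat) \<Rightarrow> bool" where
  "wp x c T Q R \<longleftrightarrow> (\<exists>t R'. t \<le> T \<and> run x c R t R' \<and> Q R')"

lemma wp_outputs:
  assumes "wp x c T (\<lambda>R. R 0 = y) (\<lambda>_. 0)" "jump_free c" "T \<le> t"
  shows "outputs_within (compile 0 c) x y t"
proof -
  obtain t' R where 1: "t' \<le> T" "run x c (\<lambda>_. 0) t' R" "R 0 = y"
    using assms(1) by (auto simp: wp_def)
  have 2: "(step (compile 0 c) x ^^ t') (0, \<lambda>_. 0) = (csize c, R)"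
    using run_compile[OF 1(2) assms(2), of "[]" "[]"] by simp
  \<comment> \<open>A halted configuration is stationary, so the exact step count may be padded to
    any larger \<open>t\<close>.\<close>
  have 3: "(step (compile 0 c) x ^^ s) (csize c, R) = (csize c, R)" for s
    by (induction s) (auto simp: step_def)
  have "(step (compile 0 c) x ^^ (t - t' + t')) (0, \<lambda>_. 0) = (csize c, R)"
    by (simp only: funpow_add o_def 2 3)
  then show ?thesis
    using 1 assms(3) by (auto simp: outputs_within_def)
qed

lemma wp_mono:
  assumes "wp x c T P R" "T \<le> T'" "\<And>R'. P R' \<Longrightarrow> Q R'"
  shows "wp x c T' Q R"
  using assms unfolding wp_def by (meson order_trans)

lemma wp_block: "Q (fold (effect x) is R) \<Longrightarrow> length is \<le> T \<Longrightarrow> wp x (Block is) T Q R"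
  unfolding wp_def using run_block by blast

lemma wp_seq:
  assumes "wp x c T\<^sub>1 P R" "\<And>R'. P R' \<Longrightarrow> wp x d T\<^sub>2 Q R'" "T\<^sub>1 + T\<^sub>2 \<le> T"
  shows "wp x (c ;; d) T Q R"
proof -
  obtain t R' where 1: "t \<le> T\<^sub>1" "run x c R t R'" "P R'"
    using assms(1) by (auto simp: wp_def)
  obtain t' R'' where 2: "t' \<le> T\<^sub>2" "run x d R' t' R''" "Q R''"
    using assms(2)[OF 1(3)] by (auto simp: wp_def)
  show ?thesis
    unfolding wp_def using run_seq[OF 1(2) 2(2)] 1(1) 2(1,3) assms(3)
    by (meson add_mono order_trans)
qed

lemma wp_block_seq:
  assumes "wp x d T\<^sub>2 Q (fold (effect x) is R)" "length is + T\<^sub>2 \<le> T"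
  shows "wp x (Block is ;; d) T Q R"
  using assms by (intro wp_seq[where P = "\<lambda>R'. R' = fold (effect x) is R"]) (auto intro: wp_block)

text \<open>Register 49 is reserved for the constant 1 that decrements the loop counters.\<close>

definition For :: "nat \<Rightarrow> com \<Rightarrow> com" where
  "For i c = While i (Block [Const 49 1, Sub i i 49] ;; c)"

lemma jump_free_For [simp]: "jump_free (For i c) = jump_free c"
  by (simp add: For_def)

text \<open>An iteration costs four steps besides the body: two to decrement, one to test, one to
  jump back. The counter is decremented first, so the body sees the indices from
  \<open>N - 1\<close> down to 0; invariants therefore speak of the indices from
  \<open>N - j\<close> on.\<close>

lemma wp_for_aux:
  assumes "i \<noteq> 49"
    and "\<And>j R. j < N \<Longrightarrow> I j R \<Longrightarrow> R i = N - j \<Longrightarrow>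
      wp x c T (\<lambda>R'. I (Suc j) R' \<and> R' i = N - Suc j) (R(49 := 1, i := N - Suc j))"
  shows "j \<le> N \<Longrightarrow> I j R \<Longrightarrow> R i = N - j \<Longrightarrow>
      wp x (For i c) ((N - j) * (T + 4) + 1) (\<lambda>R'. I N R' \<and> R' i = 0) R"
proof (induction "N - j" arbitrary: j R)
  case 0
  then show ?case by (auto simp: wp_def For_def intro!: exI[of _ 1] exI[of _ R] run_while_end)
next
  case (Suc m)
  then have j: "j < N" and m: "m = N - Suc j" by auto
  obtain t R' where 1: "t \<le> T" "run x c (R(49 := 1, i := N - Suc j)) t R'"
      "I (Suc j) R'" "R' i = N - Suc j"
    using assms(2)[OF j Suc.prems(2,3)] by (auto simp: wp_def)
  obtain t' R'' where 2: "t' \<le> (N - Suc j) * (T + 4) + 1" "run x (For i c) R' t' R''"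
      "I N R''" "R'' i = 0"
    using Suc.hyps(1)[of "Suc j" R'] m 1 j by (auto simp: wp_def)
  have "run x (Block [Const 49 1, Sub i i 49]) R 2 (R(49 := 1, i := N - Suc j))"
    using run_block[of x "[Const 49 1, Sub i i 49]" R] assms(1) Suc.prems(3)
    by (simp add: numeral_2_eq_2)
  from run_while_step[OF _ run_seq[OF this 1(2)] 2(2)[unfolded For_def]]
  have "run x (For i c) R (2 + t + t' + 2) R''"
    using Suc.prems(3) j by (simp add: For_def)
  moreover have "N - j = Suc (N - Suc j)" using j by simp
  then have "2 + t + t' + 2 \<le> (N - j) * (T + 4) + 1"
    using 1(1) 2(1) by simp
  ultimately show ?case using 2 by (auto simp: wp_def)
qed

lemma wp_for:
  assumes "i \<noteq> 49" "I 0 R" "R i = N"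
    and "\<And>j R. j < N \<Longrightarrow> I j R \<Longrightarrow> R i = N - j \<Longrightarrow>
      wp x c T (\<lambda>R'. I (Suc j) R' \<and> R' i = N - Suc j) (R(49 := 1, i := N - Suc j))"
    and "\<And>R'. I N R' \<Longrightarrow> R' i = 0 \<Longrightarrow> Q R'"
    and "N * (T + 4) + 1 \<le> T'"
  shows "wp x (For i c) T' Q R"
  using wp_mono[OF wp_for_aux[of i N I x c T 0 R]] assms by simp

section \<open>The search program\<close>

definition input_at :: "nat list \<Rightarrow> nat \<Rightarrow> nat" where
  "input_at x i = (if i < length x then x ! i else 0)"

definition entry :: "nat list \<Rightarrow> nat \<Rightarrow> nat \<Rightarrow> nat" where
  "entry x u v = input_at x (2 + u * input_at x 0 + v)"

text \<open>Registers 1 and 2 hold the number \<open>n\<close> of vertices and the parameter \<open>k\<close>. Register 3 holds the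
  number of representatives, which are stored from register 51 on, in front of the pairs of the current
  sequence, which are stored from register \<open>51 + n\<close> on. Register 50 stays 0.\<close>

definition adj_com :: "nat \<Rightarrow> nat \<Rightarrow> com" where
  "adj_com a b = Block [Const 13 0, Add 13 a 13, Const 12 2] ;;
     For 13 (Block [Add 12 12 1]) ;; Block [Add 12 12 b, Read 12 12]"

text \<open>The row offset is formed by adding the row length \<open>R a\<close> times, at five
  steps per addition; one matrix access thus takes linear time.\<close>

lemma wp_adj:
  assumes "a \<notin> {12, 13, 49}" "b \<notin> {12, 13, 49}" "R 1 = input_at x 0" "R a \<le> n" "5 * n + 6 \<le> T"
  shows "wp x (adj_com a b) T
    (\<lambda>R'. R' 12 = entry x (R a) (R b) \<and> (\<forall>r. r \<notin> {12, 13, 49} \<longrightarrow> R' r = R r)) R"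
  unfolding adj_com_def
  apply (rule wp_block_seq[where T\<^sub>2 = "5 * n + 3"])
   apply (rule wp_seq[where T\<^sub>1 = "5 * n + 1" and T\<^sub>2 = 2 and
        P = "\<lambda>R'. R' 12 = 2 + R a * input_at x 0 \<and> (\<forall>r. r \<notin> {12, 13, 49} \<longrightarrow> R' r = R r)"])
     apply (rule wp_for[where N = "R a" and T = 1 and
        I = "\<lambda>j R'. R' 12 = 2 + j * input_at x 0 \<and> (\<forall>r. r \<notin> {12, 13, 49} \<longrightarrow> R' r = R r)"])
  using assms by (auto intro!: wp_block simp: entry_def input_at_def)

section \<open>Computing the representatives\<close>

lemma all_countdown_Suc:
  assumes "j < (n::nat)"
  shows "(\<forall>w<n. n - Suc j \<le> w \<longrightarrow> P w) \<longleftrightarrow> (\<forall>w<n. n - j \<le> w \<longrightarrow> P w) \<and> P (n - Suc j)"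
proof -
  have "n - Suc j \<le> w \<longleftrightarrow> n - j \<le> w \<or> w = n - Suc j" for w using assms by auto
  moreover have "n - Suc j < n" using assms by simp
  ultimately show ?thesis by blast
qed

text \<open>Register 10 sums up both truncated differences of corresponding entries of the two rows,
  so it stays 0 exactly when the rows agree.\<close>

definition twin_com :: com where
  "twin_com = Block [Const 10 0, Const 9 0, Add 9 9 1] ;;
     For 9 (adj_com 8 9 ;; Block [Const 11 0, Add 11 11 12] ;; adj_com 4 9 ;;
       Block [Sub 15 11 12, Add 10 10 15, Sub 15 12 11, Add 10 10 15])"

definition twins :: "nat list \<Rightarrow> nat \<Rightarrow> nat \<Rightarrow> bool" where
  "twins x u v \<longleftrightarrow> (\<forall>w<input_at x 0. entry x u w = entry x v w)"

lemma wp_twin: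
  assumes "R 1 = input_at x 0" "R 4 \<le> input_at x 0" "R 8 \<le> input_at x 0"
    and "input_at x 0 * (10 * input_at x 0 + 22) + 4 \<le> T"
  shows "wp x twin_com T
    (\<lambda>R'. (R' 10 = 0 \<longleftrightarrow> twins x (R 8) (R 4)) \<and>
      (\<forall>r. r \<notin> {9, 10, 11, 12, 13, 15, 49} \<longrightarrow> R' r = R r)) R"
proof -
  let ?n = "input_at x 0"
  let ?F = "\<lambda>R'. \<forall>r. r \<notin> {9, 10, 11, 12, 13, 15, 49} \<longrightarrow> R' r = R r"
  let ?I = "\<lambda>j R'. (R' 10 = 0 \<longleftrightarrow> (\<forall>w<?n. ?n - j \<le> w \<longrightarrow> entry x (R 8) w = entry x (R 4) w)) \<and> ?F R'"
  have body: "wp x (adj_com 8 9 ;; Block [Const 11 0, Add 11 11 12] ;; adj_com 4 9 ;;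
       Block [Sub 15 11 12, Add 10 10 15, Sub 15 12 11, Add 10 10 15]) (10 * ?n + 18)
       (\<lambda>R'. ?I (Suc j) R' \<and> R' 9 = ?n - Suc j) (S(49 := 1, 9 := ?n - Suc j))"
    if j: "j < ?n" and I: "?I j S" for j S
  proof -
    note * = all_countdown_Suc[OF j, of "\<lambda>w. entry x (R 8) w = entry x (R 4) w"]
    show ?thesis
      apply (rule wp_seq[OF wp_adj[where n = ?n, OF _ _ _ _ order_refl]])
      using assms I apply (auto)[4]
       apply (rule wp_block_seq)
        apply (rule wp_seq[OF wp_adj[where n = ?n, OF _ _ _ _ order_refl]])
      using assms I apply (auto)[4]
      apply (rule wp_block)
      using I unfolding * apply auto
      done
  qed
  show ?thesis
    unfolding twin_com_def
    apply (rule wp_block_seq[where T\<^sub>2 = "?n * (10 * ?n + 22) + 1"])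
     apply (rule wp_for[where N = ?n and T = "10 * ?n + 18" and I = ?I])
    using assms apply (auto simp: twins_def)[3]
      apply (rule body; assumption)
     using assms by (auto simp: twins_def algebra_simps)
qed

definition twin_time :: "nat \<Rightarrow> nat" where
  "twin_time n = n * (10 * n + 22) + 4"

text \<open>Register 5 counts the stored representatives that are twins of the vertex in register 4:
  \<open>1 - R 10\<close> is 1 for a twin and 0 otherwise.\<close>

definition scan_com :: com where
  "scan_com = Block [Const 5 0, Const 6 0, Add 6 6 3] ;;
     For 6 (Block [Const 7 51, Add 7 7 6, Load 8 7] ;; twin_com ;;
       Block [Const 15 1, Sub 15 15 10, Add 5 5 15])"

lemma wp_scan:
  assumes "R 1 = input_at x 0" "R 4 \<le> input_at x 0" "R 3 = length L"
    and "\<forall>i<length L. R (51 + i) = L ! i \<and> L ! i \<le> input_at x 0"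
    and "length L \<le> input_at x 0"
    and "input_at x 0 * (twin_time (input_at x 0) + 10) + 4 \<le> T"
  shows "wp x scan_com T
    (\<lambda>R'. (R' 5 = 0 \<longleftrightarrow> (\<forall>u\<in>set L. \<not> twins x u (R 4))) \<and>
      (\<forall>r. r \<notin> {5, 6, 7, 8, 9, 10, 11, 12, 13, 15, 49} \<longrightarrow> R' r = R r)) R"
proof -
  let ?n = "input_at x 0" and ?l = "length L"
  let ?F = "\<lambda>R'. \<forall>r. r \<notin> {5, 6, 7, 8, 9, 10, 11, 12, 13, 15, 49} \<longrightarrow> R' r = R r"
  let ?I = "\<lambda>j R'. (R' 5 = 0 \<longleftrightarrow> (\<forall>w<?l. ?l - j \<le> w \<longrightarrow> \<not> twins x (L ! w) (R 4))) \<and> ?F R'"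
  have body: "wp x (Block [Const 7 51, Add 7 7 6, Load 8 7] ;; twin_com ;;
       Block [Const 15 1, Sub 15 15 10, Add 5 5 15]) (twin_time ?n + 6)
       (\<lambda>R'. ?I (Suc j) R' \<and> R' 6 = ?l - Suc j) (S(49 := 1, 6 := ?l - Suc j))"
    if j: "j < ?l" and I: "?I j S" for j S
  proof -
    note * = all_countdown_Suc[OF j, of "\<lambda>w. \<not> twins x (L ! w) (R 4)"]
    have lt: "?l - Suc j < ?l" using j by simp
    show ?thesis
      apply (rule wp_block_seq)
       apply (rule wp_seq[OF wp_twin[OF _ _ _ order_refl]])
      using assms I lt apply (auto)[3]
      apply (rule wp_block)
      using I assms(4) lt unfolding * apply (auto simp: twin_time_def)
      done
  qed
  have "?l * (twin_time ?n + 10) \<le> ?n * (twin_time ?n + 10)"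
    using assms(5) by (rule mult_le_mono1)
  then have le: "3 + (?l * (twin_time ?n + 10) + 1) \<le> T"
    using assms(6) by linarith
  show ?thesis
    unfolding scan_com_def
    apply (intro wp_block_seq[where T\<^sub>2 = "?l * (twin_time ?n + 10) + 1"])
     apply (rule wp_for[where N = ?l and T = "twin_time ?n + 6" and I = ?I])
    using assms apply (auto)[3]
      apply (rule body; assumption)
    using le by (auto simp: all_set_conv_all_nth)
qed

text \<open>The functional counterpart of \<open>reps_com\<close>; vertices come in decreasing order
  because the loop counts down.\<close>

fun reps :: "nat list \<Rightarrow> nat \<Rightarrow> nat list" where
  "reps x 0 = []"
| "reps x (Suc j) = (if \<forall>u\<in>set (reps x j). \<not> twins x u (input_at x 0 - Suc j)
     then reps x j @ [input_at x 0 - Suc j] else reps x j)"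

lemma length_reps: "length (reps x j) \<le> j"
  by (induction j) auto

lemma reps_le: "u \<in> set (reps x j) \<Longrightarrow> u \<le> input_at x 0"
  by (induction j) (auto split: if_splits)

definition scan_time :: "nat \<Rightarrow> nat" where
  "scan_time n = n * (twin_time n + 10) + 4"

text \<open>Every vertex is written behind the list, but the length grows only by
  \<open>1 - R 5\<close>, so a vertex with an earlier twin is overwritten later or ignored.\<close>

definition reps_com :: com where
  "reps_com = Block [Const 3 0, Const 4 0, Add 4 4 1] ;;
     For 4 (scan_com ;; Block [Const 15 51, Add 15 15 3, Store 15 4, Const 15 1, Sub 15 15 5, Add 3 3 15])"

lemma wp_reps:
  assumes "R 1 = input_at x 0" "R 50 = 0" "input_at x 0 * (scan_time (input_at x 0) + 10) + 4 \<le> T"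
  shows "wp x reps_com T
    (\<lambda>R'. R' 3 = length (reps x (input_at x 0)) \<and>
      (\<forall>i\<le>length (reps x (input_at x 0)). R' (50 + i) = (0 # reps x (input_at x 0)) ! i) \<and>
      R' 0 = R 0 \<and> R' 1 = R 1 \<and> R' 2 = R 2) R"
proof -
  let ?n = "input_at x 0"
  let ?F = "\<lambda>R'. R' 0 = R 0 \<and> R' 1 = R 1 \<and> R' 2 = R 2 \<and> R' 50 = 0"
  let ?I = "\<lambda>j R'. R' 3 = length (reps x j) \<and>
      (\<forall>i<length (reps x j). R' (51 + i) = reps x j ! i) \<and> ?F R'"
  have body: "wp x (scan_com ;; Block [Const 15 51, Add 15 15 3, Store 15 4, Const 15 1, Sub 15 15 5, Add 3 3 15])
       (scan_time ?n + 6)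
       (\<lambda>R'. ?I (Suc j) R' \<and> R' 4 = ?n - Suc j) (S(49 := 1, 4 := ?n - Suc j))"
    if j: "j < ?n" and I: "?I j S" for j S
  proof -
    have le: "length (reps x j) \<le> ?n" using length_reps[of x j] j by simp
    show ?thesis
      apply (rule wp_seq[OF wp_scan[where L = "reps x j", OF _ _ _ _ _ order_refl]])
      using assms I le apply (auto intro: reps_le nth_mem)[5]
       apply (rule wp_block)
      using I by (auto simp: scan_time_def nth_append less_Suc_eq)
  qed
  have idx: "R' (50 + i) = (0 # reps x ?n) ! i"
    if "?I ?n R'" "i \<le> length (reps x ?n)" for R' i
    using that by (cases i) auto
  show ?thesis
    unfolding reps_com_def
    apply (intro wp_block_seq[where T\<^sub>2 = "?n * (scan_time ?n + 10) + 1"])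
     apply (rule wp_for[where N = ?n and T = "scan_time ?n + 6" and I = ?I])
    using assms apply (auto)[3]
      apply (rule body; assumption)
    subgoal for R' using idx[of R'] by blast
     using assms by auto
qed

section \<open>Powers of two by repeated doubling\<close>

definition pow_com :: "nat \<Rightarrow> nat \<Rightarrow> com" where
  "pow_com c d = Block [Const d 1, Const 6 0, Add 6 6 2] ;; For 6 (Block (replicate c (Add d d d)))"

lemma funpow_double: "(effect x (Add d d d) ^^ c) R = R(d := 2 ^ c * R d)"
  by (induction c) auto

lemma wp_pow:
  assumes "d \<notin> {2, 6, 49}" "R 2 * (c + 4) + 4 \<le> T"
  shows "wp x (pow_com c d) T (\<lambda>R'. R' d = 2 ^ (c * R 2) \<and> (\<forall>r. r \<notin> {d, 6, 49} \<longrightarrow> R' r = R r)) R"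
  unfolding pow_com_def
  apply (intro wp_block_seq[where T\<^sub>2 = "R 2 * (c + 4) + 1"])
   apply (rule wp_for[where N = "R 2" and T = c and
        I = "\<lambda>j R'. R' d = 2 ^ (c * j) \<and> (\<forall>r. r \<notin> {d, 6, 49} \<longrightarrow> R' r = R r)"])
  using assms by (auto intro!: wp_block simp: funpow_double power_add)

definition pow_pow_com :: "nat \<Rightarrow> com" where
  "pow_pow_com c = pow_com c 17 ;; Block [Const 18 1] ;; For 17 (Block [Add 18 18 18])"

lemma wp_pow_pow:
  assumes "R 2 * (c + 4) + 2 ^ (c * R 2) * 5 + 6 \<le> T"
  shows "wp x (pow_pow_com c) T
    (\<lambda>R'. R' 18 = 2 ^ 2 ^ (c * R 2) \<and> (\<forall>r. r \<notin> {17, 18, 6, 49} \<longrightarrow> R' r = R r)) R"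
  unfolding pow_pow_com_def
  apply (rule wp_seq[OF wp_pow[OF _ order_refl], where T\<^sub>2 = "2 ^ (c * R 2) * 5 + 2"])
    apply simp
   apply (rule wp_block_seq[where T\<^sub>2 = "2 ^ (c * R 2) * 5 + 1"])
    apply (rule wp_for[where N = "2 ^ (c * R 2)" and T = 1 and
        I = "\<lambda>j R'. R' 18 = 2 ^ j \<and> (\<forall>r. r \<notin> {17, 18, 6, 49} \<longrightarrow> R' r = R r)"])
  using assms by (auto intro!: wp_block)

section \<open>Decoding a sequence from a number and checking it\<close>

definition popcount :: "nat \<Rightarrow> nat \<Rightarrow> nat" where
  "popcount l m = (\<Sum>i<l. m div 2 ^ i mod 2)"

text \<open>Subtracting the half twice leaves the lowest bit, which advances a pointer starting at
  register 50. After one block, register 19 holds the remaining bits for the next vertex.\<close>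

definition pick_com :: "nat \<Rightarrow> com" where
  "pick_com d = Block [Const 15 50, Const 6 0, Add 6 6 3] ;;
    For 6 (Block [Half 14 19, Sub 19 19 14, Sub 19 19 14, Add 15 15 19, Const 19 0, Add 19 19 14]) ;;
    Block [Load d 15]"

lemma wp_pick:
  assumes "d \<notin> {3, 6, 14, 15, 19, 49}" "R 3 \<le> n" "n * 10 + 5 \<le> T"
  shows "wp x (pick_com d) T
    (\<lambda>R'. R' d = R (50 + popcount (R 3) (R 19)) \<and> R' 19 = R 19 div 2 ^ R 3 \<and>
      (\<forall>r. r \<notin> {d, 6, 14, 15, 19, 49} \<longrightarrow> R' r = R r)) R"
proof -
  have dd: "m div 2 ^ j div 2 = m div (2 * 2 ^ j)" for m j :: nat by (metis div_mult2_eq mult.commute)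
  have half: "m div 2 ^ j - (m div (2 * 2 ^ j) + m div (2 * 2 ^ j)) = m div 2 ^ j mod 2" for m j :: nat
  proof -
    have "q - (q div 2 + q div 2) = q mod 2" for q :: nat by presburger
    then show ?thesis by (simp only: dd[symmetric])
  qed
  show ?thesis
    unfolding pick_com_def
    apply (rule wp_block_seq[where T\<^sub>2 = "n * 10 + 2"])
     apply (rule wp_seq[where T\<^sub>1 = "n * 10 + 1" and T\<^sub>2 = 1 and
          P = "\<lambda>R'. R' 15 = 50 + popcount (R 3) (R 19) \<and> R' 19 = R 19 div 2 ^ R 3 \<and>
            (\<forall>r. r \<notin> {6, 14, 15, 19, 49} \<longrightarrow> R' r = R r)"])
       apply (rule wp_for[where N = "R 3" and T = 6 and
          I = "\<lambda>j R'. R' 15 = 50 + popcount j (R 19) \<and> R' 19 = R 19 div 2 ^ j \<and>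
            (\<forall>r. r \<notin> {6, 14, 15, 19, 49} \<longrightarrow> R' r = R r)"])
    using assms apply simp
    using assms apply (simp add: popcount_def)
    using assms apply simp
    apply (rule wp_block)
    apply (simp add: popcount_def half dd)
    apply simp
    using assms apply simp
    using assms apply simp
    apply (rule wp_block)
    using assms apply auto
    done
qed

lemma sum_countdown_Suc:
  assumes "j < (d::nat)"
  shows "sum g {d - Suc j..<d} = (g (d - Suc j) :: nat) + sum g {d - j..<d}"
  using assms by (simp add: sum.atLeast_Suc_lessThan Suc_diff_Suc)

definition cross_com :: com where
  "cross_com = Block [Const 25 0, Const 6 0, Add 6 6 21] ;;
     For 6 (Block [Const 26 51, Add 26 26 1, Add 26 26 6, Load 26 26] ;; adj_com 23 26 ;;
       Block [Add 25 25 12] ;; adj_com 24 26 ;; Block [Add 25 25 12])"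

lemma wp_cross:
  assumes "R 1 = input_at x 0" "R 23 \<le> input_at x 0" "R 24 \<le> input_at x 0"
    and "R 21 * (10 * input_at x 0 + 22) + 4 \<le> T"
  shows "wp x cross_com T
    (\<lambda>R'. R' 25 = (\<Sum>i<R 21. entry x (R 23) (R (51 + input_at x 0 + i)) + entry x (R 24) (R (51 + input_at x 0 + i))) \<and>
      (\<forall>r. r \<notin> {6, 12, 13, 25, 26, 49} \<longrightarrow> R' r = R r)) R"
proof -
  let ?n = "input_at x 0" and ?d = "R 21"
  let ?g = "\<lambda>i. entry x (R 23) (R (51 + input_at x 0 + i)) + entry x (R 24) (R (51 + input_at x 0 + i))"
  let ?F = "\<lambda>R'. \<forall>r. r \<notin> {6, 12, 13, 25, 26, 49} \<longrightarrow> R' r = R r"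
  let ?I = "\<lambda>j R'. R' 25 = sum ?g {?d - j..<?d} \<and> ?F R'"
  have body: "wp x (Block [Const 26 51, Add 26 26 1, Add 26 26 6, Load 26 26] ;; adj_com 23 26 ;;
       Block [Add 25 25 12] ;; adj_com 24 26 ;; Block [Add 25 25 12]) (10 * ?n + 18)
       (\<lambda>R'. ?I (Suc j) R' \<and> R' 6 = ?d - Suc j) (S(49 := 1, 6 := ?d - Suc j))"
    if j: "j < ?d" and I: "?I j S" for j S
  proof -
    show ?thesis
      apply (rule wp_block_seq)
       apply (rule wp_seq[OF wp_adj[where n = ?n, OF _ _ _ _ order_refl]])
      using assms I apply (auto)[4]
       apply (rule wp_block_seq)
        apply (rule wp_seq[OF wp_adj[where n = ?n, OF _ _ _ _ order_refl]])
      using assms I apply (auto)[4]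
      apply (rule wp_block)
      using I assms(1) unfolding sum_countdown_Suc[OF j] apply auto
      done
  qed
  show ?thesis
    unfolding cross_com_def
    apply (rule wp_block_seq[where T\<^sub>2 = "?d * (10 * ?n + 22) + 1"])
     apply (rule wp_for[where N = ?d and T = "10 * ?n + 18" and I = ?I])
    using assms apply (auto)[3]
      apply (rule body; assumption)
     using assms by (auto simp: lessThan_atLeast0 algebra_simps)
qed

lemma popcount_le: "popcount l m \<le> l"
proof -
  have "popcount l m \<le> (\<Sum>i<l. 1)" unfolding popcount_def by (intro sum_mono) simp
  then show ?thesis by simp
qed

text \<open>The number of ones in the \<open>i\<close>-th block of \<open>length L\<close> bits of \<open>g\<close> selects the \<open>i\<close>-th vertex. The
  additional list element 0 makes every block select some vertex.\<close>

definition vertex_of :: "nat list \<Rightarrow> nat \<Rightarrow> nat \<Rightarrow> nat" where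
  "vertex_of L g i = (0 # L) ! popcount (length L) (g div 2 ^ (length L * i))"

definition round_ok :: "nat list \<Rightarrow> nat \<Rightarrow> (nat \<Rightarrow> nat) \<Rightarrow> nat \<Rightarrow> bool" where
  "round_ok x r vs j \<longleftrightarrow> entry x (vs (2 * j)) (vs (2 * j + 1)) \<noteq> 0 \<and>
     (\<Sum>i<2 * j. entry x (vs (2 * j)) (vs i) + entry x (vs (2 * j + 1)) (vs i)) \<le> r"

text \<open>Register 20 collects violations: 1 for a missing edge of the pair, and the truncated
  excess of the cross count over \<open>r\<close>. The pair is stored in either case.\<close>

definition round_com :: "nat \<Rightarrow> com" where
  "round_com r = pick_com 23 ;; pick_com 24 ;; adj_com 23 24 ;;
    Block [Const 15 1, Sub 15 15 12, Add 20 20 15] ;; cross_com ;;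
    Block [Const 15 r, Sub 15 25 15, Add 20 20 15, Const 15 51, Add 15 15 1, Add 15 15 21,
      Store 15 23, Const 26 1, Add 15 15 26, Store 15 24, Add 21 21 26, Add 21 21 26]"

text \<open>What the search must preserve. Register 50 supplies the dummy head of
  \<open>0 # L\<close>, from which \<open>vertex_of\<close> selects; register 16 holds the bound on
  the number of representatives, needed only after the search.\<close>

definition fixed_part :: "nat list \<Rightarrow> nat list \<Rightarrow> (nat \<Rightarrow> nat) \<Rightarrow> (nat \<Rightarrow> nat) \<Rightarrow> bool" where
  "fixed_part x L R R' \<longleftrightarrow> R' 1 = input_at x 0 \<and> R' 2 = R 2 \<and> R' 3 = length L \<and> R' 16 = R 16 \<and>
     (\<forall>i\<le>length L. R' (50 + i) = (0 # L) ! i)"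

definition round_time :: "nat \<Rightarrow> nat \<Rightarrow> nat" where
  "round_time n k = n * 20 + 10 + (5 * n + 6) + 3 + (2 * k * (10 * n + 22) + 4) + 12"

definition round_inv :: "nat list \<Rightarrow> nat list \<Rightarrow> nat \<Rightarrow> nat \<Rightarrow> nat \<Rightarrow> (nat \<Rightarrow> nat) \<Rightarrow> bool" where
  "round_inv x L r g j R \<longleftrightarrow> R 19 = g div 2 ^ (length L * (2 * j)) \<and> R 21 = 2 * j \<and>
     (\<forall>i<2 * j. R (51 + input_at x 0 + i) = vertex_of L g i) \<and>
     (R 20 = 0 \<longleftrightarrow> (\<forall>i<j. round_ok x r (vertex_of L g) i))"

lemma vertex_of_le: "\<forall>v\<in>set L. v \<le> n \<Longrightarrow> vertex_of L g i \<le> n"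
  unfolding vertex_of_def using nth_mem[of "popcount (length L) (g div 2 ^ (length L * i))" "0 # L"] popcount_le
  by (auto simp: less_Suc_eq_le)

lemma wp_round:
  assumes L: "length L \<le> input_at x 0" "\<forall>v\<in>set L. v \<le> input_at x 0"
    and R: "fixed_part x L R\<^sub>0 R" "round_inv x L r g j R" and j: "j < k"
  shows "wp x (round_com r) (round_time (input_at x 0) k)
    (\<lambda>R'. fixed_part x L R\<^sub>0 R' \<and> round_inv x L r g (Suc j) R' \<and> R' 0 = R 0 \<and> R' 18 = R 18 \<and> R' 22 = R 22) R"
proof -
  let ?n = "input_at x 0" and ?l = "length L"
  let ?v = "vertex_of L g"
  let ?B = "2 * k * (10 * ?n + 22) + 4 + 12"
  let ?A = "5 * ?n + 6 + (3 + ?B)"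
  have time: "2 * j * (10 * ?n + 22) \<le> 2 * k * (10 * ?n + 22)"
    using j by (intro mult_le_mono1) simp
  have Rs: "R 1 = ?n" "R 3 = ?l" "R 21 = 2 * j" "\<forall>i\<le>?l. R (50 + i) = (0 # L) ! i"
    "R 19 = g div 2 ^ (?l * (2 * j))"
    using R by (auto simp: fixed_part_def round_inv_def)
  have p1: "R (50 + popcount ?l (R 19)) = ?v (2 * j)"
    using Rs popcount_le by (auto simp: vertex_of_def)
  have q: "g div 2 ^ (?l * i) div 2 ^ ?l = g div 2 ^ (?l * (i + 1))" for i
    by (simp add: div_mult2_eq[symmetric] power_add mult.commute)
  have p2: "R (50 + popcount ?l (R 19 div 2 ^ ?l)) = ?v (2 * j + 1)"
    unfolding vertex_of_def Rs(5) q using Rs(4) popcount_le by blast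
  have p3: "R 19 div 2 ^ ?l div 2 ^ ?l = g div 2 ^ (?l * (2 * Suc j))"
    unfolding Rs(5) q by simp
  have vle: "?v i \<le> ?n" for i using vertex_of_le L by blast
  show ?thesis
    unfolding round_com_def
  proof (rule wp_seq[OF wp_pick[where n = ?n, OF _ _ order_refl], where T\<^sub>2 = "?n * 10 + 5 + ?A"], goal_cases)
    case (3 R\<^sub>1)
    then have R1: "R\<^sub>1 23 = ?v (2 * j)" "R\<^sub>1 19 = R 19 div 2 ^ ?l"
      "\<forall>r. r \<notin> {23, 6, 14, 15, 19, 49} \<longrightarrow> R\<^sub>1 r = R r"
      using p1 Rs by auto
    show ?case
    proof (rule wp_seq[OF wp_pick[where n = ?n, OF _ _ order_refl], where T\<^sub>2 = ?A], goal_cases)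
      case (3 R\<^sub>2)
      then have R2: "R\<^sub>2 23 = ?v (2 * j)" "R\<^sub>2 24 = ?v (2 * j + 1)"
        "R\<^sub>2 19 = g div 2 ^ (?l * (2 * Suc j))"
        "\<forall>r. r \<notin> {23, 24, 6, 14, 15, 19, 49} \<longrightarrow> R\<^sub>2 r = R r"
        using R1 Rs p2 p3 by auto
      show ?case
      proof (rule wp_seq[OF wp_adj[where n = ?n, OF _ _ _ _ order_refl], where T\<^sub>2 = "3 + ?B"], goal_cases)
        case (5 R\<^sub>3)
        then have R3: "R\<^sub>3 12 = entry x (?v (2 * j)) (?v (2 * j + 1))"
          "R\<^sub>3 23 = ?v (2 * j)" "R\<^sub>3 24 = ?v (2 * j + 1)"
          "R\<^sub>3 19 = g div 2 ^ (?l * (2 * Suc j))"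
          "\<forall>r. r \<notin> {12, 13, 23, 24, 6, 14, 15, 19, 49} \<longrightarrow> R\<^sub>3 r = R r"
          using R2 by auto
        show ?case
        proof (rule wp_block_seq[OF wp_seq[OF wp_cross[where T = "2 * k * (10 * ?n + 22) + 4"],
              where T\<^sub>2 = 12 and T = ?B]], goal_cases)
          case (5 R\<^sub>4)
          define s where "s = (\<Sum>i<2 * j. entry x (?v (2 * j)) (?v i) + entry x (?v (2 * j + 1)) (?v i))"
          have D: "R (51 + ?n + i) = ?v i" if "i < 2 * j" for i
            using R(2) that by (auto simp: round_inv_def)
          have "R\<^sub>4 25 = s"
            using 5 R3 Rs D by (auto simp: s_def intro!: sum.cong)
          then have R4: "R\<^sub>4 25 = s" "R\<^sub>4 23 = ?v (2 * j)" "R\<^sub>4 24 = ?v (2 * j + 1)"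
            "R\<^sub>4 20 = R 20 + (1 - entry x (?v (2 * j)) (?v (2 * j + 1)))"
            "R\<^sub>4 19 = g div 2 ^ (?l * (2 * Suc j))"
            "\<forall>r. r \<notin> {12, 13, 20, 23, 24, 25, 26, 6, 14, 15, 19, 49} \<longrightarrow> R\<^sub>4 r = R r"
            using 5 R3 by auto
          define S where "S = fold (effect x) [Const 15 r, Sub 15 25 15, Add 20 20 15, Const 15 51, Add 15 15 1, Add 15 15 21,
            Store 15 23, Const 26 1, Add 15 15 26, Store 15 24, Add 21 21 26, Add 21 21 26] R\<^sub>4"
          have S: "S 20 = R 20 + (1 - entry x (?v (2 * j)) (?v (2 * j + 1))) + (s - r)"
            "S 19 = g div 2 ^ (?l * (2 * Suc j))" "S 21 = 2 * Suc j"
            "S (51 + ?n + 2 * j) = ?v (2 * j)" "S (51 + ?n + (2 * j + 1)) = ?v (2 * j + 1)"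
            "\<forall>i<51 + ?n + 2 * j. i \<notin> {12, 13, 20, 21, 23, 24, 25, 26, 6, 14, 15, 19, 49} \<longrightarrow> S i = R i"
            unfolding S_def using R4 Rs by auto
          \<comment> \<open>The list ends at register \<open>50 + length L\<close>, below the new
            pair, which starts at \<open>51 + input_at x 0 + 2 * j\<close>.\<close>
          have "fixed_part x L R\<^sub>0 S"
            using R(1) S(6) L(1) unfolding fixed_part_def by auto
          moreover have "S (51 + ?n + i) = ?v i" if "i < 2 * Suc j" for i
          proof -
            consider "i < 2 * j" | "i = 2 * j" | "i = 2 * j + 1" using \<open>i < 2 * Suc j\<close> by fastforce
            then show ?thesis
            proof cases
              case 1
              then have "S (51 + ?n + i) = R (51 + ?n + i)" using S(6) by simp
              then show ?thesis using D[OF 1] by simp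
            qed (use S in simp_all)
          qed
          moreover have "S 20 = 0 \<longleftrightarrow> (\<forall>i<Suc j. round_ok x r ?v i)"
            using S(1) R(2) by (auto simp: round_inv_def round_ok_def s_def less_Suc_eq)
          moreover have "S 0 = R 0 \<and> S 18 = R 18 \<and> S 22 = R 22"
            using S(6) by auto
          ultimately have post: "fixed_part x L R\<^sub>0 S \<and> round_inv x L r g (Suc j) S \<and>
              S 0 = R 0 \<and> S 18 = R 18 \<and> S 22 = R 22"
            using S(2,3) unfolding round_inv_def by blast
          show ?case
            by (rule wp_block, fold S_def, rule post, simp)
        qed (use R3 Rs vle time in auto)
      qed (use R2 Rs vle in auto)
    qed (use R1 Rs L in auto)
  qed (use Rs L j in \<open>auto simp: round_time_def\<close>)
qed

text \<open>The code is copied from register 18 because decoding consumes it. Register 0 counts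
  accepted codes, as \<open>1 - R 20\<close> is 1 only if no violation was recorded.\<close>

definition guess_com :: "nat \<Rightarrow> com" where
  "guess_com r = Block [Const 19 0, Add 19 19 18, Const 20 0, Const 21 0, Const 22 0, Add 22 22 2] ;;
     For 22 (round_com r) ;; Block [Const 15 1, Sub 15 15 20, Add 0 0 15]"

definition guess_time :: "nat \<Rightarrow> nat \<Rightarrow> nat" where
  "guess_time n k = k * (round_time n k + 4) + 10"

definition accepts :: "nat list \<Rightarrow> nat \<Rightarrow> nat \<Rightarrow> nat list \<Rightarrow> nat \<Rightarrow> bool" where
  "accepts x r k L g \<longleftrightarrow> (\<forall>j<k. round_ok x r (vertex_of L g) j)"

lemma wp_guess:
  assumes L: "length L \<le> input_at x 0" "\<forall>v\<in>set L. v \<le> input_at x 0"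
    and R: "fixed_part x L R\<^sub>0 R"
  shows "wp x (guess_com r) (guess_time (input_at x 0) (R\<^sub>0 2))
    (\<lambda>R'. fixed_part x L R\<^sub>0 R' \<and> R' 18 = R 18 \<and>
       R' 0 = R 0 + (if accepts x r (R\<^sub>0 2) L (R 18) then 1 else 0)) R"
proof -
  let ?n = "input_at x 0" and ?k = "R\<^sub>0 2" and ?g = "R 18"
  let ?I = "\<lambda>j R'. fixed_part x L R\<^sub>0 R' \<and> round_inv x L r ?g j R' \<and> R' 0 = R 0 \<and> R' 18 = R 18"
  have body: "wp x (round_com r) (round_time ?n ?k) (\<lambda>R'. ?I (Suc j) R' \<and> R' 22 = ?k - Suc j)
      (S(49 := 1, 22 := ?k - Suc j))" if "j < ?k" "?I j S" for j S
    using that L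
    by (intro wp_mono[OF wp_round[where k = ?k and R\<^sub>0 = R\<^sub>0 and g = ?g and j = j] order_refl])
      (auto simp: fixed_part_def round_inv_def)
  show ?thesis
    unfolding guess_com_def
    apply (rule wp_block_seq[where T\<^sub>2 = "?k * (round_time ?n ?k + 4) + 1 + 3"])
     apply (rule wp_seq[where P = "?I ?k" and T\<^sub>1 = "?k * (round_time ?n ?k + 4) + 1" and T\<^sub>2 = 3])
       apply (rule wp_for[where N = ?k and T = "round_time ?n ?k" and I = ?I])
            apply simp
           apply (use R in \<open>auto simp: fixed_part_def round_inv_def\<close>)[1]
          apply (use R in \<open>auto simp: fixed_part_def\<close>)[1]
         apply (rule body; assumption)
        apply blast
       apply simp
      apply (rule wp_block)
       apply (auto simp: fixed_part_def round_inv_def accepts_def)[1]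
      apply (simp_all add: guess_time_def)
    done
qed

text \<open>The loop counter itself is the code to be tested, so all numbers below its initial value
  are tried.\<close>

definition search_com :: "nat \<Rightarrow> com" where
  "search_com r = For 18 (guess_com r)"

lemma wp_search:
  assumes L: "length L \<le> input_at x 0" "\<forall>v\<in>set L. v \<le> input_at x 0"
    and R: "fixed_part x L R\<^sub>0 R" "R 0 = 0"
    and T: "R 18 * (guess_time (input_at x 0) (R\<^sub>0 2) + 4) + 1 \<le> T"
  shows "wp x (search_com r) T
    (\<lambda>R'. fixed_part x L R\<^sub>0 R' \<and> (R' 0 = 0 \<longleftrightarrow> (\<forall>g<R 18. \<not> accepts x r (R\<^sub>0 2) L g))) R"
proof -
  let ?n = "input_at x 0" and ?k = "R\<^sub>0 2" and ?M = "R 18"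
  let ?I = "\<lambda>j R'. fixed_part x L R\<^sub>0 R' \<and>
    (R' 0 = 0 \<longleftrightarrow> (\<forall>g<?M. ?M - j \<le> g \<longrightarrow> \<not> accepts x r ?k L g))"
  have body: "wp x (guess_com r) (guess_time ?n ?k) (\<lambda>R'. ?I (Suc j) R' \<and> R' 18 = ?M - Suc j)
      (S(49 := 1, 18 := ?M - Suc j))" if j: "j < ?M" and I: "?I j S" for j S
    unfolding all_countdown_Suc[OF j] using I L
    by (intro wp_mono[OF wp_guess[where R\<^sub>0 = R\<^sub>0 and L = L] order_refl])
      (auto simp: fixed_part_def)
  show ?thesis
    unfolding search_com_def
    apply (rule wp_for[where N = ?M and T = "guess_time ?n ?k" and I = ?I])
    using R apply (auto)[3]
      apply (rule body; assumption)
    using T by auto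
qed

text \<open>In the last block a surplus of representatives is added to the count of accepted codes,
  and applying \<open>1 - R 0\<close> twice turns any positive value into 1.\<close>

definition main_com :: "nat \<Rightarrow> nat \<Rightarrow> com" where
  "main_com c r = Block [Read 1 0, Const 2 1, Read 2 2] ;; reps_com ;; pow_com c 16 ;;
     pow_pow_com (Suc c) ;; search_com r ;;
     Block [Sub 15 3 16, Add 0 0 15, Const 15 1, Sub 0 15 0, Sub 0 15 0]"

definition main_time :: "nat \<Rightarrow> nat \<Rightarrow> nat \<Rightarrow> nat" where
  "main_time c n k = 3 + (n * (scan_time n + 10) + 4 + (k * (c + 4) + 4 +
    (k * (Suc c + 4) + 2 ^ (Suc c * k) * 5 + 6 + (2 ^ 2 ^ (Suc c * k) * (guess_time n k + 4) + 1 + 5))))"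

lemma wp_main:
  defines "L \<equiv> \<lambda>x. reps x (input_at x 0)"
  shows "wp x (main_com c r) (main_time c (input_at x 0) (input_at x 1))
    (\<lambda>R. R 0 = (if 2 ^ (c * input_at x 1) < length (L x) \<or>
       (\<exists>g < 2 ^ 2 ^ (Suc c * input_at x 1). accepts x r (input_at x 1) (L x) g) then 1 else 0)) (\<lambda>_. 0)"
proof -
  let ?n = "input_at x 0" and ?k = "input_at x 1"
  let ?S = "2 ^ 2 ^ (Suc c * ?k) * (guess_time ?n ?k + 4) + 1"
  let ?C = "?k * (Suc c + 4) + 2 ^ (Suc c * ?k) * 5 + 6 + (?S + 5)"
  let ?B = "?k * (c + 4) + 4 + ?C"
  define R\<^sub>1 where "R\<^sub>1 = fold (effect x) [Read 1 0, Const 2 1, Read 2 2] (\<lambda>_. 0)"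
  have R1: "R\<^sub>1 0 = 0" "R\<^sub>1 1 = ?n" "R\<^sub>1 2 = ?k" "R\<^sub>1 50 = 0"
    by (auto simp: R\<^sub>1_def input_at_def)
  have len: "length (L x) \<le> ?n" unfolding L_def by (rule length_reps)
  have Lle: "\<forall>v\<in>set (L x). v \<le> ?n" unfolding L_def using reps_le by blast
  show ?thesis
    unfolding main_com_def main_time_def
  proof (rule wp_block_seq, fold R\<^sub>1_def, rule wp_seq[OF wp_reps[OF _ _ order_refl], where T\<^sub>2 = ?B], goal_cases)
    case (3 R\<^sub>2)
    then have R2: "R\<^sub>2 0 = 0" "R\<^sub>2 1 = ?n" "R\<^sub>2 2 = ?k" "R\<^sub>2 3 = length (L x)"
      "\<forall>i\<le>length (L x). R\<^sub>2 (50 + i) = (0 # L x) ! i"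
      using R1 by (auto simp: L_def)
    show ?case
    proof (rule wp_seq[OF wp_pow[where T = "?k * (c + 4) + 4"], where T\<^sub>2 = ?C], goal_cases)
      case (3 R\<^sub>3)
      then have R3: "R\<^sub>3 0 = 0" "R\<^sub>3 1 = ?n" "R\<^sub>3 2 = ?k" "R\<^sub>3 3 = length (L x)"
        "R\<^sub>3 16 = 2 ^ (c * ?k)"
        "\<forall>i\<le>length (L x). R\<^sub>3 (50 + i) = (0 # L x) ! i"
        using R2 by auto
      show ?case
      proof (rule wp_seq[OF wp_pow_pow[where T = "?k * (Suc c + 4) + 2 ^ (Suc c * ?k) * 5 + 6"],
            where T\<^sub>2 = "?S + 5"], goal_cases)
        case (2 R\<^sub>4)
        then have R4: "R\<^sub>4 0 = 0" "R\<^sub>4 18 = 2 ^ 2 ^ (Suc c * ?k)" "fixed_part x (L x) R\<^sub>3 R\<^sub>4"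
          using R3 by (auto simp: fixed_part_def)
        show ?case
        proof (rule wp_seq[OF wp_search[OF len Lle R4(3,1), where T = ?S], where T\<^sub>2 = 5], goal_cases)
          case (2 R\<^sub>5)
          then show ?case
            using R3 R4 by (intro wp_block) (auto simp: fixed_part_def)
        qed (use R3 R4 in auto)
      qed (use R3 in auto)
    qed (use R2 in auto)
  qed (use R1 in auto)
qed

lemma jump_free_main: "jump_free (main_com c r)"
  by (simp add: main_com_def reps_com_def scan_com_def twin_com_def adj_com_def pow_com_def
      pow_pow_com_def search_com_def guess_com_def round_com_def pick_com_def cross_com_def list_all_iff)

lemma computable_pow_pow: "computable (\<lambda>k. 2 ^ 2 ^ (e * k))"
proof -
  let ?c = "Block [Read 2 0] ;; pow_pow_com e ;; Block [Add 0 0 18]"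
  have "wp [k] ?c (1 + (k * (e + 4) + 2 ^ (e * k) * 5 + 6 + 1)) (\<lambda>R. R 0 = 2 ^ 2 ^ (e * k)) (\<lambda>_. 0)" for k
    by (rule wp_block_seq, rule wp_seq[OF wp_pow_pow[where T = "k * (e + 4) + 2 ^ (e * k) * 5 + 6"]])
      (auto intro!: wp_block)
  moreover have "jump_free ?c"
    by (simp add: pow_pow_com_def pow_com_def list_all_iff)
  ultimately show ?thesis
    unfolding computable_def using wp_outputs by blast
qed

section \<open>Correctness and running time\<close>

lemma concat_rows:
  "length (concat (map (\<lambda>i. map (f i) [0..<n]) [0..<m])) = m * n"
  "u < m \<Longrightarrow> v < n \<Longrightarrow> concat (map (\<lambda>i. map (f i) [0..<n]) [0..<m]) ! (u * n + v) = f u v"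
proof (induction m)
  case 0
  { case 1 show ?case by simp }
  { case 2 then show ?case by simp }
next
  case (Suc m)
  { case 1 show ?case using Suc.IH(1) by simp }
  { case 2
    show ?case
    proof (cases "u < m")
      case True
      have "u * n + v < Suc u * n" using 2(2) by simp
      also have "\<dots> \<le> m * n" using True by (intro mult_le_mono1) simp
      finally show ?thesis using Suc.IH(1) Suc.IH(2)[OF True 2(2)] by (simp add: nth_append)
    next
      case False
      then have "u = m" using 2(1) by simp
      then show ?thesis using Suc.IH(1) 2(2) by (simp add: nth_append)
    qed }
qed

lemma encode_entries:
  assumes "verts G = {..<n}"
  shows "input_at (encode (G, k)) 0 = n" "input_at (encode (G, k)) 1 = k" "length (encode (G, k)) = 2 + n * n"
    and "u < n \<Longrightarrow> v < n \<Longrightarrow> entry (encode (G, k)) u v = adj G u v"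
proof -
  let ?f = "\<lambda>i j. if {i, j} \<in> edges G then 1 else (0 :: nat)"
  let ?c = "concat (map (\<lambda>i. map (?f i) [0..<n]) [0..<n])"
  have x: "encode (G, k) = n # k # ?c"
    using assms by (simp add: encode_def)
  show n: "input_at (encode (G, k)) 0 = n" "input_at (encode (G, k)) 1 = k"
    unfolding x by (simp_all add: input_at_def)
  show "length (encode (G, k)) = 2 + n * n" unfolding x using concat_rows(1)[of ?f] by simp
  assume u: "u < n" and v: "v < n"
  have "u * n + v < Suc u * n" using v by simp
  also have "\<dots> \<le> n * n" using u by (intro mult_le_mono1) simp
  finally have "u * n + v < length ?c" using concat_rows(1)[of ?f n n] by simp
  then have "input_at (encode (G, k)) (2 + u * n + v) = ?c ! (u * n + v)"
    unfolding x input_at_def by (simp del: length_concat)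
  then show "entry (encode (G, k)) u v = adj G u v"
    unfolding entry_def n concat_rows(2)[OF u v, of ?f] by (simp add: adj_def)
qed

section \<open>Lists of pairs, twins and unary codes\<close>

fun pair_list :: "(nat \<Rightarrow> 'a) \<Rightarrow> nat \<Rightarrow> ('a \<times> 'a) list" where
  "pair_list vs 0 = []"
| "pair_list vs (Suc j) = (vs (2 * j), vs (2 * j + 1)) # pair_list vs j"

lemma length_pair_list [simp]: "length (pair_list vs j) = j"
  by (induction j) auto

lemma cross_pair_list: "cross G a b (pair_list vs j) = (\<Sum>i<2 * j. adj G a (vs i) + adj G b (vs i))"
  by (induction j) auto

lemma good_pair_list:
  "good G r (pair_list vs k) \<longleftrightarrow> (\<forall>j<k. adj G (vs (2 * j)) (vs (2 * j + 1)) \<noteq> 0 \<and>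
     (\<Sum>i<2 * j. adj G (vs (2 * j)) (vs i) + adj G (vs (2 * j + 1)) (vs i)) \<le> r)"
  by (induction k) (auto simp: cross_pair_list less_Suc_eq adj_def[of G "vs (2 * k)" for k])

lemma pair_list_cong: "(\<And>i. i < 2 * j \<Longrightarrow> vs i = ws i) \<Longrightarrow> pair_list vs j = pair_list ws j"
  by (induction j) auto

lemma pair_list_surj: "\<exists>vs. pair_list vs (length ps) = ps"
proof (induction ps)
  case (Cons e ps)
  then obtain vs where vs: "pair_list vs (length ps) = ps" by blast
  let ?l = "length ps"
  let ?ws = "vs(2 * ?l := fst e, 2 * ?l + 1 := snd e)"
  have "pair_list ?ws ?l = pair_list vs ?l" by (rule pair_list_cong) auto
  then have "pair_list ?ws (length (e # ps)) = e # ps" using vs by simp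
  then show ?case by blast
qed simp

lemma good_mono: "good G r ps \<Longrightarrow> r \<le> r' \<Longrightarrow> good G r' ps"
  by (induction ps rule: good.induct) auto

text \<open>Replacing one end at a time keeps every adjacency between listed vertices, and
  \<open>good\<close> looks at nothing else.\<close>

lemma good_subst_twins:
  assumes nbrs: "\<And>i. i < 2 * k \<Longrightarrow> nbrs G (ws i) = nbrs G (vs i)"
    and good: "good G r (pair_list vs k)"
  shows "good G r (pair_list ws k)"
proof -
  have "adj G (ws i) (ws j) = adj G (vs i) (vs j)" if "i < 2 * k" "j < 2 * k" for i j
  proof -
    have *: "adj G (ws i) y = adj G (vs i) y" if "i < 2 * k" for i y
      using nbrs[OF that] unfolding nbrs_def adj_def by (metis mem_Collect_eq)
    show ?thesis using *[of i "ws j"] *[of j "vs i"] that adj_commute by metis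
  qed
  then show ?thesis using good unfolding good_pair_list by simp
qed

lemma popcount_Suc: "popcount (Suc l) m = m mod 2 + popcount l (m div 2)"
  unfolding popcount_def by (subst sum.lessThan_Suc_shift) (simp add: div_mult2_eq)

lemma popcount_ones: "c \<le> l \<Longrightarrow> popcount l (2 ^ c - 1 + 2 ^ l * g) = c"
proof (induction l arbitrary: c)
  case (Suc l)
  show ?case
  proof (cases c)
    case 0
    then show ?thesis using Suc.IH[of 0] by (simp add: popcount_Suc)
  next
    case (Suc c')
    have "2 * p - 1 + 2 * q = 2 * (p - 1 + q) + 1" if "1 \<le> p" for p q :: nat
      using that by (cases p) auto
    from this[of "2 ^ c'" "2 ^ l * g"]
    have "2 ^ c - 1 + 2 ^ Suc l * g = 2 * (2 ^ c' - 1 + 2 ^ l * g) + 1"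
      unfolding Suc power_Suc mult.assoc by simp
    moreover have "popcount (Suc l) (2 * m + 1) = 1 + popcount l m" for m by (simp add: popcount_Suc)
    ultimately show ?thesis using Suc.IH[of c'] Suc.prems Suc by simp
  qed
qed (simp add: popcount_def)

text \<open>Write \<open>f i\<close> in unary into the \<open>i\<close>-th block of \<open>l\<close>
  bits, as the number \<open>2 ^ f i - 1\<close>.\<close>

lemma popcount_surj:
  assumes "\<And>i. i < m \<Longrightarrow> f i \<le> l"
  shows "\<exists>g < 2 ^ (l * m). \<forall>i<m. popcount l (g div 2 ^ (l * i)) = f i"
  using assms
proof (induction m arbitrary: f)
  case 0
  show ?case by auto
next
  case (Suc m)
  obtain g where g: "g < 2 ^ (l * m)" "\<forall>i<m. popcount l (g div 2 ^ (l * i)) = f (Suc i)"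
    using Suc.IH[of "\<lambda>i. f (Suc i)"] Suc.prems by auto
  let ?b = "2 ^ f 0 - 1 :: nat"
  let ?h = "?b + 2 ^ l * g"
  have "(2::nat) ^ f 0 \<le> 2 ^ l" using Suc.prems[of 0] by (intro power_increasing) auto
  moreover have "(0::nat) < 2 ^ f 0" by simp
  ultimately have b: "?b < 2 ^ l" by linarith
  have "2 ^ l * Suc g \<le> 2 ^ l * 2 ^ (l * m)" using g(1) by (intro mult_le_mono2) simp
  then have "?h < 2 ^ (l * Suc m)" using b by (simp add: power_add)
  moreover have "popcount l (?h div 2 ^ (l * i)) = f i" if i: "i < Suc m" for i
  proof (cases i)
    case 0
    then show ?thesis using popcount_ones[of "f 0" l g] Suc.prems[of 0] by simp
  next
    case (Suc j)
    have "?h div 2 ^ (l * i) = ?h div 2 ^ l div 2 ^ (l * j)"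
      unfolding Suc by (simp add: power_add div_mult2_eq)
    also have "(b + 2 ^ l * g) div 2 ^ l = g" if "b < 2 ^ l" for b using that by simp
    from this[OF b] have "?h div 2 ^ l = g" .
    finally show ?thesis using g(2) Suc i by simp
  qed
  ultimately show ?case by blast
qed

section \<open>The program on the encoding of a graph\<close>

locale encoded_graph =
  fixes G :: "nat sgraph" and n k :: nat and x :: "nat list"
  assumes G: "simple_graph G" and verts: "verts G = {..<n}" and k: "k > 0"
    and x: "x = encode (G, k)"
begin

lemma input_x: "input_at x 0 = n" "input_at x 1 = k" "length x = 2 + n * n"
  unfolding x using encode_entries[OF verts] by auto

lemma entry_x: "u < n \<Longrightarrow> v < n \<Longrightarrow> entry x u v = adj G u v"
  unfolding x by (rule encode_entries(4)[OF verts])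

lemma twins_iff:
  assumes "u < n" "v < n"
  shows "twins x u v \<longleftrightarrow> nbrs G u = nbrs G v"
proof -
  have "twins x u v \<longleftrightarrow> (\<forall>w<n. {u, w} \<in> edges G \<longleftrightarrow> {v, w} \<in> edges G)"
    unfolding twins_def input_x using assms by (auto simp: entry_x adj_def split: if_splits)
  moreover have "w < n" if "{u, w} \<in> edges G \<or> {v, w} \<in> edges G" for w
    using that simple_graph_edgeD(3)[OF G] verts by blast
  ultimately show ?thesis unfolding nbrs_def by blast
qed

text \<open>A vertex is kept only if no stored one has its neighbourhood, which gives injectivity,
  and dropped only if one has, which gives coverage.\<close>

lemma reps_props:
  assumes "j \<le> n"
  shows "set (reps x j) \<subseteq> {..<n} \<and> distinct (reps x j) \<and> inj_on (nbrs G) (set (reps x j)) \<and>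
    (\<forall>v<n. n - j \<le> v \<longrightarrow> (\<exists>u\<in>set (reps x j). nbrs G u = nbrs G v))"
  using assms
proof (induction j)
  case (Suc j)
  let ?L = "reps x j" and ?v = "n - Suc j"
  have v: "?v < n" using Suc.prems by simp
  have IH: "set ?L \<subseteq> {..<n}" "distinct ?L" "inj_on (nbrs G) (set ?L)"
    "\<forall>v<n. n - j \<le> v \<longrightarrow> (\<exists>u\<in>set ?L. nbrs G u = nbrs G v)"
    using Suc by auto
  have tw: "twins x u ?v \<longleftrightarrow> nbrs G u = nbrs G ?v" if "u \<in> set ?L" for u
    using IH(1) that v by (intro twins_iff) auto
  have j: "j < n" using Suc.prems by simp
  note cd = all_countdown_Suc[OF j, of "\<lambda>v. \<exists>u\<in>S. nbrs G u = nbrs G v" for S]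
  show ?case
  proof (cases "\<forall>u\<in>set ?L. nbrs G u \<noteq> nbrs G ?v")
    case True
    then have eq: "reps x (Suc j) = ?L @ [?v]" using tw by (simp add: input_x)
    have "?v \<notin> set ?L" using True by blast
    moreover have "inj_on (nbrs G) (insert ?v (set ?L))" using IH(3) True by (auto simp: inj_on_insert)
    ultimately show ?thesis unfolding cd eq using IH v by auto
  next
    case False
    then have eq: "reps x (Suc j) = ?L" using tw by (auto simp: input_x)
    show ?thesis unfolding cd eq using IH False by blast
  qed
qed simp

abbreviation "L \<equiv> reps x n"

lemma reps_complete:
  shows "set L \<subseteq> {..<n}" "card (set L) = length L" "inj_on (nbrs G) (set L)"
    and "v < n \<Longrightarrow> \<exists>u\<in>set L. nbrs G u = nbrs G v"
  using reps_props[of n] distinct_card by auto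

lemma round_ok_iff_good:
  assumes "\<And>i. i < 2 * k \<Longrightarrow> vs i < n"
  shows "(\<forall>j<k. round_ok x r vs j) \<longleftrightarrow> good G r (pair_list vs k)"
proof -
  have "round_ok x r vs j \<longleftrightarrow> adj G (vs (2 * j)) (vs (2 * j + 1)) \<noteq> 0 \<and>
     (\<Sum>i<2 * j. adj G (vs (2 * j)) (vs i) + adj G (vs (2 * j + 1)) (vs i)) \<le> r" if "j < k" for j
  proof -
    have "(\<Sum>i<2 * j. entry x (vs (2 * j)) (vs i) + entry x (vs (2 * j + 1)) (vs i)) =
      (\<Sum>i<2 * j. adj G (vs (2 * j)) (vs i) + adj G (vs (2 * j + 1)) (vs i))"
      using that assms by (intro sum.cong) (auto simp: entry_x)
    moreover have "entry x (vs (2 * j)) (vs (2 * j + 1)) = adj G (vs (2 * j)) (vs (2 * j + 1))"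
      using that assms by (intro entry_x) auto
    ultimately show ?thesis unfolding round_ok_def by simp
  qed
  then show ?thesis unfolding good_pair_list by blast
qed

text \<open>The dummy choice 0 is a vertex as soon as \<open>n > 0\<close>. For \<open>n = 0\<close>
  there is no matrix, all entries read as 0, and round 0, which exists because \<open>k > 0\<close>,
  fails.\<close>

lemma accepts_sound:
  assumes "accepts x r k L g"
  shows "\<exists>ps. good G r ps \<and> length ps = k"
proof -
  have n: "n > 0"
  proof (rule ccontr)
    assume "\<not> n > 0"
    then have n: "n = 0" by simp
    have "entry x u v = 0" for u v using input_x(3) unfolding entry_def by (simp add: input_at_def n)
    moreover have "round_ok x r (vertex_of L g) 0" using assms k by (auto simp: accepts_def)
    ultimately show False unfolding round_ok_def by simp
  qed
  have "vertex_of L g i < n" for i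
  proof -
    have "\<forall>v\<in>set L. v \<le> n - 1" using reps_complete(1) n by fastforce
    then have "vertex_of L g i \<le> n - 1" by (rule vertex_of_le)
    then show ?thesis using n by simp
  qed
  then have "good G r (pair_list (vertex_of L g) k)"
    using assms round_ok_iff_good unfolding accepts_def by blast
  then show ?thesis using length_pair_list by blast
qed

lemma accepts_complete:
  assumes "good G r ps" "length ps = k"
  shows "\<exists>g < 2 ^ (length L * (2 * k)). accepts x r k L g"
proof -
  obtain vs where vs: "pair_list vs k = ps" using pair_list_surj assms(2) by metis
  have good: "good G r (pair_list vs k)" using vs assms(1) by simp
  have "vs i < n" if i: "i < 2 * k" for i
  proof -
    obtain q where q: "i = 2 * q \<or> i = 2 * q + 1" by (meson evenE oddE)
    then have "q < k" using i by linarith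
    then have "adj G (vs (2 * q)) (vs (2 * q + 1)) \<noteq> 0" using good unfolding good_pair_list by blast
    then have "{vs (2 * q), vs (2 * q + 1)} \<in> edges G" by (simp add: adj_def split: if_splits)
    from simple_graph_edgeD(2,3)[OF G this]
    have "vs (2 * q) < n" "vs (2 * q + 1) < n" using verts by auto
    then show ?thesis using q by auto
  qed
  then have "\<forall>i<2 * k. \<exists>l<length L. nbrs G (L ! l) = nbrs G (vs i)"
    using reps_complete(4) by (metis in_set_conv_nth)
  then obtain f where f: "\<And>i. i < 2 * k \<Longrightarrow> f i < length L \<and> nbrs G (L ! f i) = nbrs G (vs i)"
    by metis
  \<comment> \<open>The successor skips the dummy at the head of \<open>0 # L\<close>.\<close>
  obtain g where g: "g < 2 ^ (length L * (2 * k))"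
    "\<forall>i<2 * k. popcount (length L) (g div 2 ^ (length L * i)) = Suc (f i)"
    using popcount_surj[of "2 * k" "\<lambda>i. Suc (f i)" "length L"] f by (metis Suc_leI)
  have v: "vertex_of L g i = L ! f i" if "i < 2 * k" for i
    using g(2) that by (simp add: vertex_of_def)
  have "good G r (pair_list (vertex_of L g) k)"
    by (rule good_subst_twins[OF _ good]) (simp add: v f)
  moreover have "vertex_of L g i < n" if "i < 2 * k" for i
    using v[OF that] f[OF that] reps_complete(1) nth_mem by fastforce
  ultimately have "accepts x r k L g" using round_ok_iff_good unfolding accepts_def by blast
  then show ?thesis using g(1) by blast
qed

end

lemma double_le_power: "k > 0 \<Longrightarrow> 2 * k \<le> (2::nat) ^ k"
proof (induction k)
  case (Suc k)
  then show ?case by (cases "k = 0") auto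
qed simp

context encoded_graph
begin

lemma answer_correct:
  assumes d: "d > 0"
    and sparse: "\<And>S. S \<subseteq> verts G \<Longrightarrow> S \<noteq> {} \<Longrightarrow> card (edges (induced_subgraph G S)) < d * card S"
    and c: "c = 8 * d + 1"
  shows "2 ^ (c * k) < length L \<or> (\<exists>g < 2 ^ 2 ^ (Suc c * k). accepts x r k L g) \<longleftrightarrow>
    (\<exists>ps. good G r ps \<and> length ps = k)" (is "?long \<or> ?found \<longleftrightarrow> ?yes")
proof
  assume "?long \<or> ?found"
  then show ?yes
  proof
    assume long: ?long
    show ?yes
    proof (cases "\<exists>M. matching G M \<and> 4 * d * k \<le> card M")
      case True
      then show ?thesis using sparse_matching_good[OF G d sparse] good_mono by (metis le0)
    next
      case False
      then have "card M \<le> 4 * d * k" if "matching G M" for M using that by (meson linear)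
      then have "card (set L) \<le> 2 * (4 * d * k) + 2 ^ (2 * (4 * d * k))"
        using reps_complete(1,3) verts by (intro card_distinct_nbrs_le[OF G]) auto
      also have "\<dots> \<le> 2 ^ (2 * (4 * d * k)) + 2 ^ (2 * (4 * d * k))"
        by (intro add_right_mono less_imp_le less_exp)
      also have "\<dots> = 2 ^ (8 * d * k + 1)" by (simp add: mult.assoc)
      \<comment> \<open>Here \<open>k \<ge> 1\<close> absorbs the extra 1 in the exponent, which
        explains \<open>c = 8 * d + 1\<close>.\<close>
      also have "\<dots> \<le> 2 ^ (c * k)" using k by (intro power_increasing) (auto simp: c)
      finally show ?thesis using long reps_complete(2) by simp
    qed
  next
    assume ?found
    then show ?yes using accepts_sound by blast
  qed
next
  assume ?yes
  then obtain g where g: "g < 2 ^ (length L * (2 * k))" "accepts x r k L g"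
    using accepts_complete by blast
  show "?long \<or> ?found"
  proof (cases ?long)
    case False
    \<comment> \<open>The bit length of a code. The factor \<open>2 * k \<le> 2 ^ k\<close> raises
      \<open>c\<close> to \<open>Suc c\<close> in the search range.\<close>
    then have "length L * (2 * k) \<le> 2 ^ (c * k) * 2 ^ k"
      using double_le_power[OF k] by (intro mult_le_mono) auto
    also have "\<dots> = 2 ^ (Suc c * k)" by (simp add: power_add)
    finally have "(2::nat) ^ (length L * (2 * k)) \<le> 2 ^ 2 ^ (Suc c * k)" by (rule power_increasing) simp
    then show ?thesis using g less_le_trans by blast
  qed simp
qed

lemma input_size_ge: "n + 2 \<le> input_size x + 1" "2 \<le> input_size x"
proof -
  have "(\<Sum>a\<leftarrow>x. 1) \<le> (\<Sum>a\<leftarrow>x. Suc (floorlog 2 a))" by (rule sum_list_mono) simp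
  then have "length x \<le> input_size x" by (simp add: input_size_def sum_list_triv)
  then have "2 + n * n \<le> input_size x" by (simp add: input_x)
  moreover have "n \<le> n * n" by (cases n) auto
  ultimately show "n + 2 \<le> input_size x + 1" "2 \<le> input_size x" by linarith+
qed

end

text \<open>Polynomial terms in \<open>k\<close> and \<open>n\<close> are dominated by
  \<open>Q\<close>, which costs two factors \<open>K \<le> M\<close>; the search loop is the third
  factor \<open>M\<close>. Then \<open>3 * K \<le> 4 * K\<close> turns \<open>Suc c\<close> into
  \<open>c + 3\<close>. Collecting representatives takes time of order \<open>n ^ 4\<close>, and
  constants are at most \<open>2 ^ 8 \<le> z ^ 8\<close>, whence the exponent 12.\<close>

lemma main_time_le:
  assumes k: "k > 0" and z: "n + 1 \<le> z" "2 \<le> z"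
  shows "main_time c n k \<le> 2 ^ 2 ^ ((c + 3) * k) * z ^ 12"
proof -
  define P where "P = (n + 1) ^ 4"
  define K where "K = (2::nat) ^ (Suc c * k)"
  define M where "M = (2::nat) ^ K"
  have pw: "(n + 1) ^ i \<le> P" if "i \<le> 4" for i
    unfolding P_def using that by (intro power_increasing) auto
  have nP: "n ^ i \<le> P" if "i \<le> 4" for i
    using pw[OF that] power_mono[of n "n + 1" i] by linarith
  have P: "1 \<le> P" "n \<le> P" "n * n \<le> P" "n * n * n \<le> P" "n * n * n * n \<le> P"
    using nP[of 0] nP[of 1] nP[of 2] nP[of 3] nP[of 4]
    by (simp_all add: power2_eq_square power3_eq_cube power4_eq_xxxx mult.assoc)
  have K: "Suc c * k \<le> K" unfolding K_def by (intro less_imp_le less_exp)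
  have kK: "k \<le> K" using K by simp
  have ckK: "c * k \<le> K" using K by simp
  have K1: "1 \<le> K" using kK k by simp
  have KM: "K \<le> M" unfolding M_def by (intro less_imp_le less_exp)
  have reps: "n * (scan_time n + 10) + 4 \<le> 64 * P"
    using P by (simp add: scan_time_def twin_time_def algebra_simps)
  define Q where "Q = K * K * P"
  have Q: "1 \<le> Q" "k \<le> Q" "k * n \<le> Q" "k * k \<le> Q" "k * k * n \<le> Q" "P \<le> Q" "K \<le> Q"
  proof -
    have KK: "1 \<le> K * K" "k \<le> K * K" "k * k \<le> K * K" "K \<le> K * K"
      using mult_le_mono[OF K1 K1] mult_le_mono[OF K1 kK] mult_le_mono[OF kK kK] mult_le_mono[OF K1 order_refl]
      by simp_all
    show "1 \<le> Q" "k \<le> Q" "k * n \<le> Q" "k * k \<le> Q" "k * k * n \<le> Q" "P \<le> Q" "K \<le> Q"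
      unfolding Q_def
      using mult_le_mono[OF KK(1) P(1)] mult_le_mono[OF KK(2) P(1)] mult_le_mono[OF KK(2) P(2)]
        mult_le_mono[OF KK(3) P(1)] mult_le_mono[OF KK(3) P(2)] mult_le_mono[OF KK(1) order_refl[of P]]
        mult_le_mono[OF KK(4) P(1)] by simp_all
  qed
  have guess: "guess_time n k + 4 \<le> 142 * Q"
    using Q by (simp add: guess_time_def round_time_def algebra_simps)
  have M1: "1 \<le> M" using K1 KM by simp
  have QM: "Q \<le> M * Q" using M1 by simp
  have "main_time c n k \<le> 3 + (64 * P + (c * k + 4 * k + 4 + (c * k + 5 * k + K * 5 + 6 + (M * (142 * Q) + 1 + 5))))"
    unfolding main_time_def K_def[symmetric] M_def[symmetric]
    by (intro add_mono order_refl reps mult_le_mono guess) (simp_all add: algebra_simps)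
  also have "\<dots> \<le> 64 * Q + 19 * Q + 16 * Q + M * (142 * Q)"
    using Q kK ckK by linarith
  also have "\<dots> \<le> 256 * (M * Q)" using QM by linarith
  also have "\<dots> \<le> 2 ^ 8 * (M * (M * M * P))"
    unfolding Q_def using KM by (intro mult_le_mono) auto
  also have "\<dots> = (M * M * M) * (2 ^ 8 * P)" by simp
  also have "\<dots> \<le> 2 ^ 2 ^ ((c + 3) * k) * (z ^ 8 * z ^ 4)"
  proof (rule mult_le_mono)
    have "M * M * M = 2 ^ (3 * K)" by (simp add: M_def power_add[symmetric])
    also have "\<dots> \<le> 2 ^ (2 ^ 2 * K)" by (rule power_increasing) auto
    also have "2 ^ 2 * K = 2 ^ (Suc c * k + 2)" by (simp add: K_def power_add)
    also have "(2::nat) ^ 2 ^ (Suc c * k + 2) \<le> 2 ^ 2 ^ ((c + 3) * k)"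
      using k by (intro power_increasing) (auto simp: algebra_simps)
    finally show "M * M * M \<le> 2 ^ 2 ^ ((c + 3) * k)" .
    show "2 ^ 8 * P \<le> z ^ 8 * z ^ 4"
      unfolding P_def using z by (intro mult_le_mono power_mono) auto
  qed
  finally show ?thesis by (simp flip: power_add)
qed

text \<open>The class enters the program only through the constant \<open>c\<close>. Sparsity is
  needed for all induced subgraphs of the input, and these belong to the class.\<close>

lemma good_problem_fpt:
  assumes "graph_class \<H>" "minor_closed \<H>" "proper_class \<H>"
    and yes: "\<And>G k. simple_graph G \<Longrightarrow> yes (G, k) \<longleftrightarrow> (\<exists>ps. good G r ps \<and> length ps = k)"
  shows "fixed_parameter_tractable (instances \<H>) encode parameter yes"
proof -
  obtain d where d: "d > 0"
    "\<And>G. G \<in> \<H> \<Longrightarrow> verts G \<noteq> {} \<Longrightarrow> card (edges G) < d * card (verts G)"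
    using proper_minor_closed_sparse[OF assms(1-3)] by blast
  define c where "c = 8 * d + 1"
  have "outputs_within (compile 0 (main_com c r)) (encode p) (if yes p then 1 else 0)
      (2 ^ 2 ^ ((c + 3) * parameter p) * input_size (encode p) ^ 12)" if p: "p \<in> instances \<H>" for p
  proof -
    obtain G k n where inst: "p = (G, k)" "G \<in> \<H>" "verts G = {..<n}" "k > 0"
      using p by (auto simp: instances_def)
    have simp: "simple_graph G" using inst(2) assms(1) by (simp add: graph_class_def)
    interpret encoded_graph G n k "encode p"
      using simp inst by unfold_locales auto
    have sparse: "card (edges (induced_subgraph G S)) < d * card S" if "S \<subseteq> verts G" "S \<noteq> {}" for S
    proof -
      have "verts (induced_subgraph G S) = S" using that(1) by (auto simp: induced_subgraph_def)
      then show ?thesis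
        using d(2)[OF induced_subgraph_closed[OF minor_steps_closedI[OF assms(1,2)] inst(2)], of S] that(2) by simp
    qed
    have time: "main_time c n k \<le> 2 ^ 2 ^ ((c + 3) * k) * input_size (encode p) ^ 12"
      using main_time_le[OF k] input_size_ge by simp
    have "yes p \<longleftrightarrow> (\<exists>ps. good G r ps \<and> length ps = k)" unfolding inst(1) by (rule yes[OF simp])
    then have answer: "(2 ^ (c * k) < length L \<or>
        (\<exists>g < 2 ^ 2 ^ (Suc c * k). accepts (encode p) r k L g)) = yes p"
      using answer_correct[OF d(1) sparse c_def, of r] by blast
    have "wp (encode p) (main_com c r) (main_time c n k) (\<lambda>R. R 0 = (if yes p then 1 else 0)) (\<lambda>_. 0)"
      using wp_main[of "encode p" c r] unfolding input_x answer .
    from wp_outputs[OF this jump_free_main time] show ?thesis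
      unfolding parameter_def inst(1) by simp
  qed
  then show ?thesis
    unfolding fixed_parameter_tractable_def
    using computable_pow_pow[of "c + 3"]
    by (intro exI[of _ "compile 0 (main_com c r)"] exI[of _ "\<lambda>k. 2 ^ 2 ^ ((c + 3) * k)"] exI[of _ 12]) auto
qed

theorem theorem9:
  fixes \<H> :: "nat sgraph set"
  assumes "graph_class \<H>"
    and "minor_closed \<H>"
    and "proper_class \<H>"
  shows "fixed_parameter_tractable (instances \<H>) encode parameter acyclic_matching_problem \<and>
    fixed_parameter_tractable (instances \<H>) encode parameter induced_matching_problem"
proof
  show "fixed_parameter_tractable (instances \<H>) encode parameter acyclic_matching_problem"
    using acyclic_matching_iff_good
    by (intro good_problem_fpt[OF assms, where r = 1]) (simp add: acyclic_matching_problem_def)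
  show "fixed_parameter_tractable (instances \<H>) encode parameter induced_matching_problem"
    using induced_matching_iff_good
    by (intro good_problem_fpt[OF assms, where r = 0]) (simp add: induced_matching_problem_def)
qed

end
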